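(* Let $G$ be a group, let $\chi \colon G \to \mathbb{Z}$ be an integral character, and let $C_\bullet$ be a chain complex of projective $\mathbb{Z}[G]$-modules such that $C_i = 0$ for all $i > n$, for some $n \in \mathbb{Z}$, and assume that $C_n$ is finitely generated. The following are equivalent: (1) $H^n(C_\bullet; \widehat{\mathbb{Z}[G]}^{\chi}) = 0$ and $H^n(C_\bullet; \widehat{\mathbb{Z}[G]}^{-\chi}) = 0$; (2) $C_\bullet$ is chain homotopy equivalent over $\mathbb{Z}[\ker \chi]$ to a chain complex $D_\bullet$ of projective $\mathbb{Z}[\ker \chi]$-modules such that $D_i = 0$ for all $i > n-1$.
   Context: A character of $G$ is a homomorphism $\chi \colon G \to \mathbb{R}$; an integral character is one with $\chi(G) \subseteq \mathbb{Q}$ and $\chi(G)\cong\mathbb{Z}$ (here the image is in $\mathbb{Z}$). For a character $\chi$, the Novikov ring $\widehat{\mathbb{Z}[G]}^{\chi}$ is the ring of formal series $\sum_{g\in G} r_g g$ with $r_g \in \mathbb{Z}$ such that for every $t \in \mathbb{R}$ the set $\{g \in G : r_g \neq 0,\ \chi(g) \leq t\}$ is finite; multiplication extends that of $\mathbb{Z}[G]$, which is a subring, so $\widehat{\mathbb{Z}[G]}^{\chi}$ is a $\mathbb{Z}[G]$-module by multiplication. Chain complexes are indexed by $\mathbb{Z}$ with boundary maps $C_i \to C_{i-1}$, and $H^i(C_\bullet; M)$ denotes the $i$th cohomology of the cochain complex $\mathrm{Hom}_{\mathbb{Z}[G]}(C_\bullet, M)$ for a $\mathbb{Z}[G]$-module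 $M$ (on the same side as $C_\bullet$). *)

theory Defs
  imports Complex_Main "HOL-Algebra.Module" "HOL-Algebra.Elementary_Groups"
begin

section \<open>Left modules over a not necessarily commutative ring\<close>

text \<open>
  The library locale \<^locale>\<open>module\<close> requires a commutative ring. The record type
  \<^type>\<open>module\<close> is reused here; its multiplicative fields play no role.
\<close>

locale left_module = R?: ring R + M?: abelian_group M
  for R :: "('r, 'k) ring_scheme" (structure) and M :: "('r, 'm) module" (structure) +
  assumes smult_closed [simp, intro]:
      "\<lbrakk>a \<in> carrier R; x \<in> carrier M\<rbrakk> \<Longrightarrow> a \<odot>\<^bsub>M\<^esub> x \<in> carrier M"
    and smult_l_distr:
      "\<lbrakk>a \<in> carrier R; b \<in> carrier R; x \<in> carrier M\<rbrakk> \<Longrightarrow>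
        (a \<oplus> b) \<odot>\<^bsub>M\<^esub> x = a \<odot>\<^bsub>M\<^esub> x \<oplus>\<^bsub>M\<^esub> b \<odot>\<^bsub>M\<^esub> x"
    and smult_r_distr:
      "\<lbrakk>a \<in> carrier R; x \<in> carrier M; y \<in> carrier M\<rbrakk> \<Longrightarrow>
        a \<odot>\<^bsub>M\<^esub> (x \<oplus>\<^bsub>M\<^esub> y) = a \<odot>\<^bsub>M\<^esub> x \<oplus>\<^bsub>M\<^esub> a \<odot>\<^bsub>M\<^esub> y"
    and smult_assoc:
      "\<lbrakk>a \<in> carrier R; b \<in> carrier R; x \<in> carrier M\<rbrakk> \<Longrightarrow>
        (a \<otimes> b) \<odot>\<^bsub>M\<^esub> x = a \<odot>\<^bsub>M\<^esub> (b \<odot>\<^bsub>M\<^esub> x)"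
    and smult_one [simp]:
      "x \<in> carrier M \<Longrightarrow> \<one> \<odot>\<^bsub>M\<^esub> x = x"

definition lmod_hom ::
    "('r, 'k) ring_scheme \<Rightarrow> ('r, 'm) module \<Rightarrow> ('r, 'n) module \<Rightarrow> ('m \<Rightarrow> 'n) set" where
  "lmod_hom R M N = {f. f \<in> carrier M \<rightarrow> carrier N \<and>
     (\<forall>x\<in>carrier M. \<forall>y\<in>carrier M. f (x \<oplus>\<^bsub>M\<^esub> y) = f x \<oplus>\<^bsub>N\<^esub> f y) \<and>
     (\<forall>a\<in>carrier R. \<forall>x\<in>carrier M. f (a \<odot>\<^bsub>M\<^esub> x) = a \<odot>\<^bsub>N\<^esub> f x)}"

definition lmod_isomorphic ::
    "('r, 'k) ring_scheme \<Rightarrow> ('r, 'm) module \<Rightarrow> ('r, 'n) module \<Rightarrow> bool" where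
  "lmod_isomorphic R M N \<longleftrightarrow> (\<exists>f \<in> lmod_hom R M N. bij_betw f (carrier M) (carrier N))"

definition zero_module :: "('r, 'm) module \<Rightarrow> bool" where
  "zero_module M \<longleftrightarrow> carrier M = {\<zero>\<^bsub>M\<^esub>}"

definition finitely_generated_module :: "('r, 'k) ring_scheme \<Rightarrow> ('r, 'm) module \<Rightarrow> bool" where
  "finitely_generated_module R M \<longleftrightarrow>
     (\<exists>S. finite S \<and> S \<subseteq> carrier M \<and>
       (\<forall>x\<in>carrier M. \<exists>a \<in> S \<rightarrow> carrier R. x = (\<Oplus>\<^bsub>M\<^esub>s\<in>S. a s \<odot>\<^bsub>M\<^esub> s)))"

definition direct_sum_module ::
    "('r, 'm) module \<Rightarrow> ('r, 'n) module \<Rightarrow> ('r, 'm \<times> 'n) module" where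
  "direct_sum_module M N =
     \<lparr>carrier = carrier M \<times> carrier N, monoid.mult = undefined, one = undefined,
      ring.zero = (\<zero>\<^bsub>M\<^esub>, \<zero>\<^bsub>N\<^esub>),
      ring.add = (\<lambda>x y. (fst x \<oplus>\<^bsub>M\<^esub> fst y, snd x \<oplus>\<^bsub>N\<^esub> snd y)),
      module.smult = (\<lambda>a x. (a \<odot>\<^bsub>M\<^esub> fst x, a \<odot>\<^bsub>N\<^esub> snd x))\<rparr>"

text \<open>The free module with basis \<open>X\<close>: finitely supported functions from \<open>X\<close> to \<open>R\<close>.\<close>

definition free_module :: "('r, 'k) ring_scheme \<Rightarrow> 'x set \<Rightarrow> ('r, 'x \<Rightarrow> 'r) module" where
  "free_module R X =
     \<lparr>carrier = {f. (\<forall>x\<in>X. f x \<in> carrier R) \<and> (\<forall>x. x \<notin> X \<longrightarrow> f x = \<zero>\<^bsub>R\<^esub>) \<and>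
                    finite {x. f x \<noteq> \<zero>\<^bsub>R\<^esub>}},
      monoid.mult = undefined, one = undefined,
      ring.zero = (\<lambda>x. \<zero>\<^bsub>R\<^esub>),
      ring.add = (\<lambda>f g x. f x \<oplus>\<^bsub>R\<^esub> g x),
      module.smult = (\<lambda>a f x. a \<otimes>\<^bsub>R\<^esub> f x)\<rparr>"

text \<open>
  Projective means direct summand of a free module. Fixing the type of the basis and of the
  complement loses nothing: a projective \<open>P\<close> is a direct summand of the free module on the set
  \<open>carrier P\<close>, with the kernel of the canonical surjection as a complement.
\<close>

definition projective_module :: "('r, 'k) ring_scheme \<Rightarrow> ('r, 'm) module \<Rightarrow> bool" where
  "projective_module R P \<longleftrightarrow> left_module R P \<and>
     (\<exists>(Q :: ('r, 'm \<Rightarrow> 'r) module) (X :: 'm set).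
        left_module R Q \<and> lmod_isomorphic R (direct_sum_module P Q) (free_module R X))"


section \<open>Chain complexes\<close>

text \<open>
  A complex is given by its modules \<open>C i\<close> and boundary maps \<open>d i : C i \<rightarrow> C (i - 1)\<close>.
  Using a single carrier type for all the \<open>C i\<close> is no restriction, since the
  carriers are arbitrary, possibly overlapping, subsets of it.
\<close>

definition chain_complex ::
    "('r, 'k) ring_scheme \<Rightarrow> (int \<Rightarrow> ('r, 'm) module) \<Rightarrow> (int \<Rightarrow> 'm \<Rightarrow> 'm) \<Rightarrow> bool" where
  "chain_complex R C d \<longleftrightarrow>
     (\<forall>i. left_module R (C i)) \<and>
     (\<forall>i. d i \<in> lmod_hom R (C i) (C (i - 1))) \<and>
     (\<forall>i. \<forall>x\<in>carrier (C i). d (i - 1) (d i x) = \<zero>\<^bsub>C (i - 1 - 1)\<^esub>)"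

definition chain_map ::
    "('r, 'k) ring_scheme \<Rightarrow> (int \<Rightarrow> ('r, 'm) module) \<Rightarrow> (int \<Rightarrow> 'm \<Rightarrow> 'm) \<Rightarrow>
     (int \<Rightarrow> ('r, 'n) module) \<Rightarrow> (int \<Rightarrow> 'n \<Rightarrow> 'n) \<Rightarrow> (int \<Rightarrow> 'm \<Rightarrow> 'n) \<Rightarrow> bool" where
  "chain_map R C d D e f \<longleftrightarrow>
     (\<forall>i. f i \<in> lmod_hom R (C i) (D i)) \<and>
     (\<forall>i. \<forall>x\<in>carrier (C i). e i (f i x) = f (i - 1) (d i x))"

definition chain_homotopic ::
    "('r, 'k) ring_scheme \<Rightarrow> (int \<Rightarrow> ('r, 'm) module) \<Rightarrow> (int \<Rightarrow> 'm \<Rightarrow> 'm) \<Rightarrow>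
     (int \<Rightarrow> ('r, 'n) module) \<Rightarrow> (int \<Rightarrow> 'n \<Rightarrow> 'n) \<Rightarrow>
     (int \<Rightarrow> 'm \<Rightarrow> 'n) \<Rightarrow> (int \<Rightarrow> 'm \<Rightarrow> 'n) \<Rightarrow> bool" where
  "chain_homotopic R C d D e f g \<longleftrightarrow>
     (\<exists>s. (\<forall>i. s i \<in> lmod_hom R (C i) (D (i + 1))) \<and>
          (\<forall>i. \<forall>x\<in>carrier (C i).
             f i x \<ominus>\<^bsub>D i\<^esub> g i x = e (i + 1) (s i x) \<oplus>\<^bsub>D i\<^esub> s (i - 1) (d i x)))"

definition chain_homotopy_equivalent ::
    "('r, 'k) ring_scheme \<Rightarrow> (int \<Rightarrow> ('r, 'm) module) \<Rightarrow> (int \<Rightarrow> 'm \<Rightarrow> 'm) \<Rightarrow>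
     (int \<Rightarrow> ('r, 'n) module) \<Rightarrow> (int \<Rightarrow> 'n \<Rightarrow> 'n) \<Rightarrow> bool" where
  "chain_homotopy_equivalent R C d D e \<longleftrightarrow>
     (\<exists>f g. chain_map R C d D e f \<and> chain_map R D e C d g \<and>
        chain_homotopic R C d C d (\<lambda>i. g i \<circ> f i) (\<lambda>i. id) \<and>
        chain_homotopic R D e D e (\<lambda>i. f i \<circ> g i) (\<lambda>i. id))"


section \<open>Cohomology with coefficients in a module\<close>

text \<open>
  Homomorphisms are taken to be extensional (\<open>undefined\<close> off the carrier) here, so that
  equality of elements of \<open>hom_group\<close> is equality of homomorphisms.
\<close>

definition hom_group ::
    "('r, 'k) ring_scheme \<Rightarrow> ('r, 'm) module \<Rightarrow> ('r, 'n) module \<Rightarrow> ('m \<Rightarrow> 'n) monoid" where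
  "hom_group R M N =
     \<lparr>carrier = lmod_hom R M N \<inter> extensional (carrier M),
      monoid.mult = (\<lambda>f g. \<lambda>x\<in>carrier M. f x \<oplus>\<^bsub>N\<^esub> g x),
      one = (\<lambda>x\<in>carrier M. \<zero>\<^bsub>N\<^esub>)\<rparr>"

text \<open>The coboundary from \<open>Hom (C i, M)\<close> to \<open>Hom (C (i + 1), M)\<close>.\<close>

definition coboundary ::
    "(int \<Rightarrow> ('r, 'm) module) \<Rightarrow> (int \<Rightarrow> 'm \<Rightarrow> 'm) \<Rightarrow> int \<Rightarrow> ('m \<Rightarrow> 'n) \<Rightarrow> 'm \<Rightarrow> 'n" where
  "coboundary C d i \<phi> = (\<lambda>x\<in>carrier (C (i + 1)). \<phi> (d (i + 1) x))"

definition cohomology ::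
    "('r, 'k) ring_scheme \<Rightarrow> (int \<Rightarrow> ('r, 'm) module) \<Rightarrow> (int \<Rightarrow> 'm \<Rightarrow> 'm) \<Rightarrow>
     ('r, 'n) module \<Rightarrow> int \<Rightarrow> ('m \<Rightarrow> 'n) set monoid" where
  "cohomology R C d M i =
     (hom_group R (C i) M)
       \<lparr>carrier := kernel (hom_group R (C i) M) (hom_group R (C (i + 1)) M) (coboundary C d i)\<rparr>
     Mod (coboundary C d (i - 1) ` carrier (hom_group R (C (i - 1)) M))"


section \<open>Characters\<close>

definition real_group :: "real monoid" where
  "real_group = \<lparr>carrier = UNIV, monoid.mult = (+), one = 0\<rparr>"

definition character :: "('g, 'b) monoid_scheme \<Rightarrow> ('g \<Rightarrow> real) \<Rightarrow> bool" where
  "character G \<chi> \<longleftrightarrow> \<chi> \<in> hom G real_group"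

definition integral_character :: "('g, 'b) monoid_scheme \<Rightarrow> ('g \<Rightarrow> real) \<Rightarrow> bool" where
  "integral_character G \<chi> \<longleftrightarrow> character G \<chi> \<and> \<chi> ` carrier G \<subseteq> \<rat> \<and>
     real_group\<lparr>carrier := \<chi> ` carrier G\<rparr> \<cong> integer_group"


section \<open>Group rings and Novikov rings\<close>

text \<open>
  A formal series over \<open>G\<close> is a function \<open>'g \<Rightarrow> int\<close> vanishing outside \<open>carrier G\<close>.
  The sum below is finite for the series that occur in a group ring or a Novikov ring.
\<close>

definition series_mult ::
    "('g, 'b) monoid_scheme \<Rightarrow> ('g \<Rightarrow> int) \<Rightarrow> ('g \<Rightarrow> int) \<Rightarrow> ('g \<Rightarrow> int)" where
  "series_mult G r s = (\<lambda>g. \<Sum>(h, k) | h \<in> carrier G \<and> k \<in> carrier G \<and> h \<otimes>\<^bsub>G\<^esub> k = g \<and>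
                               r h \<noteq> 0 \<and> s k \<noteq> 0. r h * s k)"

definition series_ring ::
    "('g, 'b) monoid_scheme \<Rightarrow> ('g \<Rightarrow> int) set \<Rightarrow> ('g \<Rightarrow> int) ring" where
  "series_ring G A =
     \<lparr>carrier = A, monoid.mult = series_mult G,
      one = (\<lambda>g. if g = \<one>\<^bsub>G\<^esub> then 1 else 0),
      ring.zero = (\<lambda>g. 0), ring.add = (\<lambda>r s g. r g + s g)\<rparr>"

definition group_ring :: "('g, 'b) monoid_scheme \<Rightarrow> ('g \<Rightarrow> int) ring" where
  "group_ring G = series_ring G
     {r. (\<forall>g. g \<notin> carrier G \<longrightarrow> r g = 0) \<and> finite {g \<in> carrier G. r g \<noteq> 0}}"

definition novikov_ring :: "('g, 'b) monoid_scheme \<Rightarrow> ('g \<Rightarrow> real) \<Rightarrow> ('g \<Rightarrow> int) ring" where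
  "novikov_ring G \<chi> = series_ring G
     {r. (\<forall>g. g \<notin> carrier G \<longrightarrow> r g = 0) \<and>
         (\<forall>t::real. finite {g \<in> carrier G. r g \<noteq> 0 \<and> \<chi> g \<le> t})}"

text \<open>The Novikov ring as a left module over the group ring.\<close>

definition novikov_module ::
    "('g, 'b) monoid_scheme \<Rightarrow> ('g \<Rightarrow> real) \<Rightarrow> ('g \<Rightarrow> int, 'g \<Rightarrow> int) module" where
  "novikov_module G \<chi> =
     ring.extend (novikov_ring G \<chi>) (module.fields (monoid.mult (novikov_ring G \<chi>)))"

text \<open>
  For a subgroup \<open>K\<close> the elements of the group ring of \<open>K\<close> are literally elements of the group
  ring of \<open>G\<close>; so restriction of scalars along the inclusion does not change the record
  representing a module.
\<close>

definition character_kernel ::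
    "('g, 'b) monoid_scheme \<Rightarrow> ('g \<Rightarrow> real) \<Rightarrow> ('g, 'b) monoid_scheme" where
  "character_kernel G \<chi> = G\<lparr>carrier := kernel G real_group \<chi>\<rparr>"

end

theory Submission
  imports Defs
begin

text \<open>
  Write \<open>K\<close> for the kernel of \<open>\<chi>\<close>. Both conditions say the same thing about the top boundary map
  \<open>d : C n \<rightarrow> C (n - 1)\<close>, namely that it has a retraction \<open>\<rho>\<close> that is linear over the group ring
  of \<open>K\<close>.

  For the complex \<open>D\<close> this is formal. Given \<open>\<rho>\<close>, the map that is \<open>1 - d \<rho>\<close> in degree \<open>n - 1\<close>,
  the identity below and \<open>0\<close> above is an idempotent chain map homotopic to the identity, and its
  image is the complex wanted (\<open>lower_dimension\<close>). It is projective, since the group ring of \<open>G\<close>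
  is free over that of \<open>K\<close> (\<open>projective_over_kernel\<close>). Conversely, if the identity of \<open>C\<close>
  is homotopic to a map that factors through a complex vanishing in degree \<open>n\<close>, the component of
  the homotopy in degree \<open>n - 1\<close> is, up to sign, a retraction of \<open>d\<close>
  (\<open>retraction_of_top_boundary\<close>).

  Since \<open>C (n + 1) = 0\<close>, vanishing of the cohomology means that every linear map from \<open>C n\<close> to the
  Novikov module factors through \<open>d\<close> (\<open>top_cohomology_trivial_iff\<close>). If this holds for \<open>\<chi>\<close> and
  for \<open>- \<chi>\<close>, each coordinate of the finitely generated projective module \<open>C n\<close> factors as \<open>u d\<close>
  and as \<open>v d\<close>, with values in the two Novikov modules. The part of \<open>u q\<close> in levels \<open>\<chi> \<le> 0\<close> and
  the part of \<open>v q\<close> in levels \<open>\<chi> > 0\<close> are finite. Their sum lies in the group ring, depends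
  linearly over \<open>K\<close> on \<open>q\<close>, and for \<open>q = d x\<close> is the given coordinate of \<open>x\<close>. So these sums are the
  coordinates of a retraction (\<open>retraction_from_factorisations\<close>).

  For the converse one may embed \<open>C (n - 1)\<close> in a free module, whose elements can be cut at a
  level. A linear map \<open>\<psi>\<close> into the Novikov module is determined by a single coefficient of its
  values, because all others arise by translation; so \<open>\<psi>\<close> with \<open>\<psi> d = \<phi>\<close> could be read off from
  \<open>\<phi> \<rho>\<close>, except that \<open>\<rho>\<close>, being only linear over \<open>K\<close>, may move levels by arbitrary amounts,
  and the resulting series need not satisfy the finiteness condition. The remedy is to replace
  \<open>\<rho>\<close> by
  \<open>\<rho>' q = \<rho> (q\<^sub><) + \<rho> ((d \<rho> q)\<^sub>\<ge>)\<close>,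
  where \<open>q\<^sub><\<close> and \<open>q\<^sub>\<ge>\<close> are the parts of \<open>q\<close> in levels below \<open>0\<close> and from \<open>0\<close> on. This is again
  a retraction. If \<open>q\<close> lives in levels \<open>\<ge> 0\<close>, the first term vanishes. In the second term
  \<open>d \<rho> q\<close> is a combination of the finitely many \<open>d p\<close>, for \<open>p\<close> in a generating set of \<open>C n\<close>. As
  \<open>d p\<close> meets finitely many levels, multiples \<open>a d p\<close> with \<open>a\<close> in high levels survive
  the cut intact, and \<open>\<rho>\<close> sends them to \<open>a p\<close>; those with \<open>a\<close> in low levels are killed; and
  between these lie finitely many levels of \<open>a\<close>, for each of which linearity over \<open>K\<close> gives a bound. So
  \<open>\<phi> \<rho>'\<close> is bounded below on the elements of nonnegative level
  (\<open>truncated_multiples_bounded_below\<close>), and this is what the finiteness condition requires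
  (\<open>novikov_map_of_bounded_kernel_map\<close>).
\<close>

section \<open>Linear maps, linear combinations and dual bases\<close>

lemma lmod_homI:
  assumes "\<And>x. x \<in> carrier M \<Longrightarrow> f x \<in> carrier N"
    and "\<And>x y. x \<in> carrier M \<Longrightarrow> y \<in> carrier M \<Longrightarrow> f (x \<oplus>\<^bsub>M\<^esub> y) = f x \<oplus>\<^bsub>N\<^esub> f y"
    and "\<And>a x. a \<in> carrier R \<Longrightarrow> x \<in> carrier M \<Longrightarrow> f (a \<odot>\<^bsub>M\<^esub> x) = a \<odot>\<^bsub>N\<^esub> f x"
  shows "f \<in> lmod_hom R M N"
  using assms by (auto simp: lmod_hom_def)

lemma lmod_homD:
  assumes "f \<in> lmod_hom R M N"
  shows lmod_hom_closed: "x \<in> carrier M \<Longrightarrow> f x \<in> carrier N"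
    and lmod_hom_add: "x \<in> carrier M \<Longrightarrow> y \<in> carrier M \<Longrightarrow> f (x \<oplus>\<^bsub>M\<^esub> y) = f x \<oplus>\<^bsub>N\<^esub> f y"
    and lmod_hom_smult: "a \<in> carrier R \<Longrightarrow> x \<in> carrier M \<Longrightarrow> f (a \<odot>\<^bsub>M\<^esub> x) = a \<odot>\<^bsub>N\<^esub> f x"
  using assms by (auto simp: lmod_hom_def)

lemma lmod_hom_restrict_scalars:
  "carrier R' \<subseteq> carrier R \<Longrightarrow> f \<in> lmod_hom R M N \<Longrightarrow> f \<in> lmod_hom R' M N"
  by (auto simp: lmod_hom_def)

lemma lmod_hom_comp:
  "f \<in> lmod_hom R M N \<Longrightarrow> g \<in> lmod_hom R N L \<Longrightarrow> g \<circ> f \<in> lmod_hom R M L"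
  by (rule lmod_homI) (auto simp: lmod_homD)

lemma lmod_hom_id: "id \<in> lmod_hom R M M"
  by (simp add: lmod_hom_def)

lemma lmod_hom_zero:
  assumes "abelian_group M" "abelian_group N" "f \<in> lmod_hom R M N"
  shows "f \<zero>\<^bsub>M\<^esub> = \<zero>\<^bsub>N\<^esub>"
proof -
  interpret M: abelian_group M by fact
  interpret N: abelian_group N by fact
  have c: "f \<zero>\<^bsub>M\<^esub> \<in> carrier N" using assms(3) by (auto simp: lmod_homD)
  have "f \<zero>\<^bsub>M\<^esub> \<oplus>\<^bsub>N\<^esub> f \<zero>\<^bsub>M\<^esub> = f \<zero>\<^bsub>M\<^esub>"
    using lmod_hom_add[OF assms(3), of "\<zero>\<^bsub>M\<^esub>" "\<zero>\<^bsub>M\<^esub>"] by simp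
  then show ?thesis using c N.add.l_cancel_one' by metis
qed

lemma lmod_hom_minus:
  assumes "abelian_group M" "abelian_group N" "f \<in> lmod_hom R M N" "x \<in> carrier M"
  shows "f (\<ominus>\<^bsub>M\<^esub> x) = \<ominus>\<^bsub>N\<^esub> f x"
proof -
  interpret M: abelian_group M by fact
  interpret N: abelian_group N by fact
  have "f (\<ominus>\<^bsub>M\<^esub> x) \<oplus>\<^bsub>N\<^esub> f x = \<zero>\<^bsub>N\<^esub>"
    using lmod_hom_add[OF assms(3), of "\<ominus>\<^bsub>M\<^esub> x" x] assms(4)
      lmod_hom_zero[OF assms(1-3)] by (simp add: M.l_neg)
  then show ?thesis
    using N.minus_equality assms(3,4) by (metis M.a_inv_closed lmod_hom_closed)
qed

lemma lmod_hom_finsum: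
  assumes "abelian_group M" "abelian_group N" "f \<in> lmod_hom R M N" "x \<in> A \<rightarrow> carrier M"
  shows "f (\<Oplus>\<^bsub>M\<^esub>i\<in>A. x i) = (\<Oplus>\<^bsub>N\<^esub>i\<in>A. f (x i))"
proof -
  interpret M: abelian_group M by fact
  interpret N: abelian_group N by fact
  show ?thesis
    using assms(4)
  proof (induction A rule: infinite_finite_induct)
    case (insert i A)
    have "f (\<Oplus>\<^bsub>M\<^esub>i\<in>insert i A. x i) = f (x i \<oplus>\<^bsub>M\<^esub> (\<Oplus>\<^bsub>M\<^esub>i\<in>A. x i))"
      using insert by simp
    also have "\<dots> = f (x i) \<oplus>\<^bsub>N\<^esub> (\<Oplus>\<^bsub>N\<^esub>i\<in>A. f (x i))"
      using insert assms(3) by (simp add: lmod_homD Pi_def)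
    also have "\<dots> = (\<Oplus>\<^bsub>N\<^esub>i\<in>insert i A. f (x i))"
      using insert assms(3) by (subst N.finsum_insert) (auto simp: lmod_homD Pi_def)
    finally show ?case .
  qed (use lmod_hom_zero[OF assms(1-3)] in auto)
qed

context left_module
begin

lemma is_abelian_group: "abelian_group M" ..

lemma smult_zero_left [simp]: "x \<in> carrier M \<Longrightarrow> \<zero> \<odot>\<^bsub>M\<^esub> x = \<zero>\<^bsub>M\<^esub>"
  by (metis M.add.l_cancel_one' R.l_zero R.zero_closed smult_closed smult_l_distr)

lemma smult_zero_right [simp]: "a \<in> carrier R \<Longrightarrow> a \<odot>\<^bsub>M\<^esub> \<zero>\<^bsub>M\<^esub> = \<zero>\<^bsub>M\<^esub>"
  by (metis M.add.l_cancel_one' M.l_zero M.zero_closed smult_closed smult_r_distr)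

lemma smult_minus_right:
  "a \<in> carrier R \<Longrightarrow> x \<in> carrier M \<Longrightarrow> a \<odot>\<^bsub>M\<^esub> (\<ominus>\<^bsub>M\<^esub> x) = \<ominus>\<^bsub>M\<^esub> (a \<odot>\<^bsub>M\<^esub> x)"
  by (metis M.a_inv_closed M.l_neg M.minus_equality smult_closed smult_r_distr smult_zero_right)

lemma smult_minus_left:
  "a \<in> carrier R \<Longrightarrow> x \<in> carrier M \<Longrightarrow> (\<ominus> a) \<odot>\<^bsub>M\<^esub> x = \<ominus>\<^bsub>M\<^esub> (a \<odot>\<^bsub>M\<^esub> x)"
  by (metis M.minus_equality R.a_inv_closed R.l_neg smult_closed smult_l_distr smult_zero_left)

lemma smult_finsum_right:
  assumes "a \<in> carrier R" "x \<in> A \<rightarrow> carrier M"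
  shows "a \<odot>\<^bsub>M\<^esub> (\<Oplus>\<^bsub>M\<^esub>i\<in>A. x i) = (\<Oplus>\<^bsub>M\<^esub>i\<in>A. a \<odot>\<^bsub>M\<^esub> x i)"
  using assms(2)
proof (induction A rule: infinite_finite_induct)
  case (insert i A)
  then have "(\<Oplus>\<^bsub>M\<^esub>i\<in>insert i A. a \<odot>\<^bsub>M\<^esub> x i) = a \<odot>\<^bsub>M\<^esub> x i \<oplus>\<^bsub>M\<^esub> (\<Oplus>\<^bsub>M\<^esub>i\<in>A. a \<odot>\<^bsub>M\<^esub> x i)"
    using assms(1) by (intro M.finsum_insert) (auto simp: Pi_def)
  then show ?case using insert assms(1) by (simp add: smult_r_distr Pi_def)
qed (use assms(1) in auto)

lemma minus_lmod_hom:
  assumes f: "f \<in> lmod_hom R N M"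
  shows "(\<lambda>x. \<ominus>\<^bsub>M\<^esub> f x) \<in> lmod_hom R N M"
  by (rule lmod_homI) (use f in \<open>auto simp: lmod_homD smult_minus_right M.minus_add M.add.m_comm\<close>)

lemma add_lmod_hom:
  assumes f: "f \<in> lmod_hom R N M" and g: "g \<in> lmod_hom R N M"
  shows "(\<lambda>x. f x \<oplus>\<^bsub>M\<^esub> g x) \<in> lmod_hom R N M"
proof (rule lmod_homI)
  fix x y assume "x \<in> carrier N" "y \<in> carrier N"
  then have "f x \<in> carrier M" "f y \<in> carrier M" "g x \<in> carrier M" "g y \<in> carrier M"
    using f g by (auto simp: lmod_homD)
  then show "f (x \<oplus>\<^bsub>N\<^esub> y) \<oplus>\<^bsub>M\<^esub> g (x \<oplus>\<^bsub>N\<^esub> y) = f x \<oplus>\<^bsub>M\<^esub> g x \<oplus>\<^bsub>M\<^esub> (f y \<oplus>\<^bsub>M\<^esub> g y)"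
    using \<open>x \<in> _\<close> \<open>y \<in> _\<close>
    by (simp add: lmod_hom_add[OF f] lmod_hom_add[OF g] M.a_ac)
qed (use f g in \<open>auto simp: lmod_homD smult_r_distr\<close>)

lemma zero_lmod_hom: "(\<lambda>x. \<zero>\<^bsub>M\<^esub>) \<in> lmod_hom R N M"
  by (rule lmod_homI) auto

lemma submodule_left_module:
  assumes "H \<subseteq> carrier M" "\<zero>\<^bsub>M\<^esub> \<in> H"
    and "\<And>x y. x \<in> H \<Longrightarrow> y \<in> H \<Longrightarrow> x \<oplus>\<^bsub>M\<^esub> y \<in> H"
    and "\<And>x. x \<in> H \<Longrightarrow> \<ominus>\<^bsub>M\<^esub> x \<in> H"
    and "\<And>a x. a \<in> carrier R \<Longrightarrow> x \<in> H \<Longrightarrow> a \<odot>\<^bsub>M\<^esub> x \<in> H"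
  shows "left_module R (M\<lparr>carrier := H\<rparr>)"
proof -
  have "abelian_group (M\<lparr>carrier := H\<rparr>)"
  proof (rule abelian_groupI)
    fix x assume "x \<in> carrier (M\<lparr>carrier := H\<rparr>)"
    then show "\<exists>y\<in>carrier (M\<lparr>carrier := H\<rparr>). y \<oplus>\<^bsub>M\<lparr>carrier := H\<rparr>\<^esub> x = \<zero>\<^bsub>M\<lparr>carrier := H\<rparr>\<^esub>"
      using assms by (intro bexI[of _ "\<ominus>\<^bsub>M\<^esub> x"]) (auto simp: M.l_neg subset_eq)
  qed (use assms in \<open>auto simp: subset_eq M.a_assoc intro: M.a_comm\<close>)
  then show ?thesis
    using assms by (intro left_module.intro left_module_axioms.intro R.ring_axioms)
      (auto simp: subset_eq smult_l_distr smult_r_distr smult_assoc)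
qed

end

lemma free_module_simps:
  "\<zero>\<^bsub>free_module R X\<^esub> = (\<lambda>x. \<zero>\<^bsub>R\<^esub>)"
  "f \<oplus>\<^bsub>free_module R X\<^esub> g = (\<lambda>x. f x \<oplus>\<^bsub>R\<^esub> g x)"
  "a \<odot>\<^bsub>free_module R X\<^esub> f = (\<lambda>x. a \<otimes>\<^bsub>R\<^esub> f x)"
  by (auto simp: free_module_def)

lemma free_module_carrier:
  "f \<in> carrier (free_module R X) \<longleftrightarrow>
     (\<forall>x\<in>X. f x \<in> carrier R) \<and> (\<forall>x. x \<notin> X \<longrightarrow> f x = \<zero>\<^bsub>R\<^esub>) \<and> finite {x. f x \<noteq> \<zero>\<^bsub>R\<^esub>}"
  by (auto simp: free_module_def)

lemma (in ring) free_module_coeff: "f \<in> carrier (free_module R X) \<Longrightarrow> f x \<in> carrier R"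
  by (cases "x \<in> X") (auto simp: free_module_carrier)

lemma (in ring) free_left_module: "left_module R (free_module R X)"
proof -
  let ?F = "free_module R X"
  have add: "f \<oplus>\<^bsub>?F\<^esub> g \<in> carrier ?F" if "f \<in> carrier ?F" "g \<in> carrier ?F" for f g
  proof -
    have "finite {x. f x \<oplus> g x \<noteq> \<zero>}"
      by (rule finite_subset[of _ "{x. f x \<noteq> \<zero>} \<union> {x. g x \<noteq> \<zero>}"])
        (use that in \<open>auto simp: free_module_carrier\<close>)
    then show ?thesis using that by (auto simp: free_module_carrier free_module_simps)
  qed
  have smult: "a \<odot>\<^bsub>?F\<^esub> g \<in> carrier ?F" if "a \<in> carrier R" "g \<in> carrier ?F" for a g
  proof -
    have "finite {x. a \<otimes> g x \<noteq> \<zero>}"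
      by (rule finite_subset[of _ "{x. g x \<noteq> \<zero>}"])
        (use that in \<open>auto simp: free_module_carrier\<close>)
    then show ?thesis using that by (auto simp: free_module_carrier free_module_simps)
  qed
  have neg: "(\<lambda>x. \<ominus> g x) \<in> carrier ?F" if "g \<in> carrier ?F" for g
  proof -
    have "finite {x. \<ominus> g x \<noteq> \<zero>}"
      by (rule finite_subset[of _ "{x. g x \<noteq> \<zero>}"])
        (use that in \<open>auto simp: free_module_carrier\<close>)
    then show ?thesis using that by (auto simp: free_module_carrier)
  qed
  have "abelian_group ?F"
  proof (rule abelian_groupI)
    fix f assume f: "f \<in> carrier ?F"
    show "\<exists>y\<in>carrier ?F. y \<oplus>\<^bsub>?F\<^esub> f = \<zero>\<^bsub>?F\<^esub>"
      by (rule bexI[OF _ neg[OF f]])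
        (use free_module_coeff[OF f] in \<open>simp add: free_module_simps l_neg\<close>)
  next
    show "\<zero>\<^bsub>?F\<^esub> \<in> carrier ?F" by (simp add: free_module_carrier free_module_simps)
  qed (use add in \<open>auto simp: free_module_simps fun_eq_iff a_assoc free_module_coeff intro: a_comm\<close>)
  moreover have "f x \<in> carrier R" if "f \<in> carrier ?F" for f x
    using that by (rule free_module_coeff)
  ultimately show ?thesis
    using smult
    by (intro left_module.intro left_module_axioms.intro ring_axioms)
      (auto simp: free_module_simps fun_eq_iff l_distr r_distr m_assoc)
qed

definition lincomb ::
    "('r, 'k) ring_scheme \<Rightarrow> ('r, 'm) module \<Rightarrow> ('x \<Rightarrow> 'm) \<Rightarrow> ('x \<Rightarrow> 'r) \<Rightarrow> 'm" where
  "lincomb R M b c = (\<Oplus>\<^bsub>M\<^esub>y\<in>{y. c y \<noteq> \<zero>\<^bsub>R\<^esub>}. c y \<odot>\<^bsub>M\<^esub> b y)"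

definition unit_vector :: "('r, 'k) ring_scheme \<Rightarrow> 'x \<Rightarrow> 'x \<Rightarrow> 'r" where
  "unit_vector R y = (\<lambda>z. if z = y then \<one>\<^bsub>R\<^esub> else \<zero>\<^bsub>R\<^esub>)"

lemma (in ring) unit_vector_closed: "y \<in> X \<Longrightarrow> unit_vector R y \<in> carrier (free_module R X)"
  by (auto simp: unit_vector_def free_module_carrier)

context left_module
begin

lemma lincomb_eq_finsum:
  assumes "c \<in> carrier (free_module R X)" "b \<in> X \<rightarrow> carrier M"
    and "finite A" "A \<subseteq> X" "{y. c y \<noteq> \<zero>} \<subseteq> A"
  shows "lincomb R M b c = (\<Oplus>\<^bsub>M\<^esub>y\<in>A. c y \<odot>\<^bsub>M\<^esub> b y)"
  unfolding lincomb_def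
  by (rule M.add.finprod_mono_neutral_cong_left)
    (use assms R.free_module_coeff[OF assms(1)] in \<open>auto simp: subset_eq Pi_def\<close>)

lemma lincomb_closed:
  assumes "c \<in> carrier (free_module R X)" "b \<in> X \<rightarrow> carrier M"
  shows "lincomb R M b c \<in> carrier M"
  unfolding lincomb_def
  by (rule M.finsum_closed) (use assms in \<open>auto simp: free_module_carrier Pi_def\<close>)

lemma lincomb_lmod_hom:
  assumes b: "b \<in> X \<rightarrow> carrier M"
  shows "lincomb R M b \<in> lmod_hom R (free_module R X) M"
proof (rule lmod_homI)
  interpret F: left_module R "free_module R X" by (rule R.free_left_module)
  fix c c' assume c: "c \<in> carrier (free_module R X)" "c' \<in> carrier (free_module R X)"
  let ?A = "{y. c y \<noteq> \<zero>} \<union> {y. c' y \<noteq> \<zero>}"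
  have A: "finite ?A" "?A \<subseteq> X" using c by (auto simp: free_module_carrier)
  then have bA: "b y \<in> carrier M" if "y \<in> ?A" for y using that b by blast
  have cc: "c \<oplus>\<^bsub>free_module R X\<^esub> c' \<in> carrier (free_module R X)" using c by simp
  have "lincomb R M b (c \<oplus>\<^bsub>free_module R X\<^esub> c') = (\<Oplus>\<^bsub>M\<^esub>y\<in>?A. (c y \<oplus> c' y) \<odot>\<^bsub>M\<^esub> b y)"
    by (subst lincomb_eq_finsum[OF cc b A]) (auto simp: free_module_simps)
  also have "\<dots> = (\<Oplus>\<^bsub>M\<^esub>y\<in>?A. c y \<odot>\<^bsub>M\<^esub> b y \<oplus>\<^bsub>M\<^esub> c' y \<odot>\<^bsub>M\<^esub> b y)"
    by (rule M.finsum_cong')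
      (use A bA c[THEN R.free_module_coeff] in \<open>auto simp: smult_l_distr\<close>)
  also have "\<dots> = (\<Oplus>\<^bsub>M\<^esub>y\<in>?A. c y \<odot>\<^bsub>M\<^esub> b y) \<oplus>\<^bsub>M\<^esub> (\<Oplus>\<^bsub>M\<^esub>y\<in>?A. c' y \<odot>\<^bsub>M\<^esub> b y)"
    by (rule M.finsum_addf) (use bA c[THEN R.free_module_coeff] in auto)
  also have "\<dots> = lincomb R M b c \<oplus>\<^bsub>M\<^esub> lincomb R M b c'"
    using lincomb_eq_finsum[OF c(1) b A] lincomb_eq_finsum[OF c(2) b A] by simp
  finally show "lincomb R M b (c \<oplus>\<^bsub>free_module R X\<^esub> c') = \<dots>" .
next
  interpret F: left_module R "free_module R X" by (rule R.free_left_module)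
  fix a c assume a: "a \<in> carrier R" and c: "c \<in> carrier (free_module R X)"
  let ?A = "{y. c y \<noteq> \<zero>}"
  have A: "finite ?A" "?A \<subseteq> X" using c by (auto simp: free_module_carrier)
  then have bA: "b y \<in> carrier M" if "y \<in> ?A" for y using that b by blast
  have ac: "a \<odot>\<^bsub>free_module R X\<^esub> c \<in> carrier (free_module R X)" using a c by simp
  have "lincomb R M b (a \<odot>\<^bsub>free_module R X\<^esub> c) = (\<Oplus>\<^bsub>M\<^esub>y\<in>?A. (a \<otimes> c y) \<odot>\<^bsub>M\<^esub> b y)"
    by (subst lincomb_eq_finsum[OF ac b A]) (use a in \<open>auto simp: free_module_simps\<close>)
  also have "\<dots> = (\<Oplus>\<^bsub>M\<^esub>y\<in>?A. a \<odot>\<^bsub>M\<^esub> (c y \<odot>\<^bsub>M\<^esub> b y))"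
    by (rule M.finsum_cong')
      (use bA a R.free_module_coeff[OF c] in \<open>auto simp: smult_assoc\<close>)
  also have "\<dots> = a \<odot>\<^bsub>M\<^esub> lincomb R M b c"
    unfolding lincomb_def
    by (rule smult_finsum_right[symmetric])
      (use bA a R.free_module_coeff[OF c] in auto)
  finally show "lincomb R M b (a \<odot>\<^bsub>free_module R X\<^esub> c) = a \<odot>\<^bsub>M\<^esub> lincomb R M b c" .
qed (rule lincomb_closed[OF _ b])

lemma lincomb_unit_vector:
  assumes "b \<in> X \<rightarrow> carrier M" "y \<in> X"
  shows "lincomb R M b (unit_vector R y) = b y"
proof -
  have "lincomb R M b (unit_vector R y) = (\<Oplus>\<^bsub>M\<^esub>z\<in>{y}. unit_vector R y z \<odot>\<^bsub>M\<^esub> b z)"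
    by (rule lincomb_eq_finsum[OF R.unit_vector_closed[OF assms(2)] assms(1)])
      (use assms in \<open>auto simp: unit_vector_def\<close>)
  also have "\<dots> = b y" using assms by (simp add: unit_vector_def Pi_def)
  finally show ?thesis .
qed

end

lemma lmod_hom_lincomb:
  assumes M: "left_module R M" and N: "left_module R N" and f: "f \<in> lmod_hom R M N"
    and b: "b \<in> X \<rightarrow> carrier M" and c: "c \<in> carrier (free_module R X)"
  shows "f (lincomb R M b c) = lincomb R N (f \<circ> b) c"
proof -
  interpret M: left_module R M by fact
  interpret N: left_module R N by fact
  have *: "c y \<odot>\<^bsub>M\<^esub> b y \<in> carrier M" "f (c y \<odot>\<^bsub>M\<^esub> b y) = c y \<odot>\<^bsub>N\<^esub> f (b y)"
    "c y \<odot>\<^bsub>N\<^esub> f (b y) \<in> carrier N"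
    if "c y \<noteq> \<zero>\<^bsub>R\<^esub>" for y
  proof -
    have "y \<in> X" using that c by (auto simp: free_module_carrier)
    then have "b y \<in> carrier M" "c y \<in> carrier R" "f (b y) \<in> carrier N"
      using b c lmod_hom_closed[OF f] by (auto simp: free_module_carrier)
    then show "c y \<odot>\<^bsub>M\<^esub> b y \<in> carrier M" "f (c y \<odot>\<^bsub>M\<^esub> b y) = c y \<odot>\<^bsub>N\<^esub> f (b y)"
      "c y \<odot>\<^bsub>N\<^esub> f (b y) \<in> carrier N"
      using f by (auto simp: lmod_homD)
  qed
  have "f (lincomb R M b c) = (\<Oplus>\<^bsub>N\<^esub>y\<in>{y. c y \<noteq> \<zero>\<^bsub>R\<^esub>}. f (c y \<odot>\<^bsub>M\<^esub> b y))"
    unfolding lincomb_def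
    by (rule lmod_hom_finsum[OF M.is_abelian_group N.is_abelian_group f]) (auto intro: *)
  also have "\<dots> = lincomb R N (f \<circ> b) c"
    unfolding lincomb_def by (rule N.finsum_cong') (auto simp: *)
  finally show ?thesis .
qed

lemma (in ring) free_finsum_apply:
  assumes "f \<in> A \<rightarrow> carrier (free_module R X)"
  shows "(\<Oplus>\<^bsub>free_module R X\<^esub>i\<in>A. f i) z = (\<Oplus>i\<in>A. f i z)"
proof -
  interpret F: left_module R "free_module R X" by (rule free_left_module)
  show ?thesis
    using assms
  proof (induction A rule: infinite_finite_induct)
    case (insert i A)
    then have "(\<Oplus>i\<in>insert i A. f i z) = f i z \<oplus> (\<Oplus>i\<in>A. f i z)"
      by (intro finsum_insert) (auto simp: Pi_def intro: free_module_coeff)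
    then show ?case using insert by (simp add: free_module_simps)
  qed (auto simp: free_module_simps)
qed

lemma (in ring) lincomb_unit_vectors:
  assumes c: "c \<in> carrier (free_module R X)"
  shows "lincomb R (free_module R X) (unit_vector R) c = c"
proof
  fix z
  let ?F = "free_module R X" and ?A = "{y. c y \<noteq> \<zero>}"
  interpret F: left_module R ?F by (rule free_left_module)
  have A: "finite ?A" "?A \<subseteq> X" using c by (auto simp: free_module_carrier)
  have cl: "c y \<odot>\<^bsub>?F\<^esub> unit_vector R y \<in> carrier ?F" if "y \<in> ?A" for y
    using that A free_module_coeff[OF c] unit_vector_closed[of y X] by auto
  have "lincomb R ?F (unit_vector R) c z = (\<Oplus>y\<in>?A. (c y \<odot>\<^bsub>?F\<^esub> unit_vector R y) z)"
    unfolding lincomb_def by (rule free_finsum_apply) (use cl in auto)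
  also have "\<dots> = (\<Oplus>y\<in>?A. if z = y then c y else \<zero>)"
    by (rule finsum_cong') (use free_module_coeff[OF c] in \<open>auto simp: free_module_simps unit_vector_def\<close>)
  also have "\<dots> = c z"
  proof (cases "z \<in> ?A")
    case True
    then show ?thesis using free_module_coeff[OF c] A by (intro finsum_singleton) auto
  next
    case False
    then have "(\<Oplus>y\<in>?A. if z = y then c y else \<zero>) = (\<Oplus>y\<in>?A. \<zero>)"
      by (intro finsum_cong') auto
    then show ?thesis using False by simp
  qed
  finally show "lincomb R ?F (unit_vector R) c z = c z" .
qed

text \<open>
  A family \<open>b\<close> of elements with finitely supported linear coordinates \<open>c\<close>. Having one is equivalent to
  being projective, and in contrast to a complement in a free module it passes at once to retracts
  and leaves the type of the index set open.
\<close>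

definition dual_basis ::
    "('r, 'k) ring_scheme \<Rightarrow> ('r, 'm) module \<Rightarrow> 'x set \<Rightarrow> ('x \<Rightarrow> 'm) \<Rightarrow> ('m \<Rightarrow> 'x \<Rightarrow> 'r) \<Rightarrow> bool"
  where
  "dual_basis R P X b c \<longleftrightarrow> b \<in> X \<rightarrow> carrier P \<and> c \<in> lmod_hom R P (free_module R X) \<and>
     (\<forall>x\<in>carrier P. lincomb R P b (c x) = x)"

lemma direct_sum_left_module:
  assumes M: "left_module R M" and N: "left_module R N"
  shows "left_module R (direct_sum_module M N)"
proof -
  interpret M: left_module R M by fact
  interpret N: left_module R N by fact
  have "abelian_group (direct_sum_module M N)"
  proof (rule abelian_groupI)
    fix x assume "x \<in> carrier (direct_sum_module M N)"
    then show "\<exists>y\<in>carrier (direct_sum_module M N).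
        y \<oplus>\<^bsub>direct_sum_module M N\<^esub> x = \<zero>\<^bsub>direct_sum_module M N\<^esub>"
      by (intro bexI[of _ "(\<ominus>\<^bsub>M\<^esub> fst x, \<ominus>\<^bsub>N\<^esub> snd x)"])
        (auto simp: direct_sum_module_def M.l_neg N.l_neg)
  qed (auto simp: direct_sum_module_def M.a_assoc N.a_assoc intro: M.a_comm N.a_comm)
  then show ?thesis
    by (intro left_module.intro left_module_axioms.intro M.R.ring_axioms)
      (auto simp: direct_sum_module_def M.smult_l_distr N.smult_l_distr M.smult_r_distr
        N.smult_r_distr M.smult_assoc N.smult_assoc)
qed

lemma lmod_hom_inverse:
  assumes f: "f \<in> lmod_hom R M N" and M: "left_module R M"
    and bij: "bij_betw f (carrier M) (carrier N)"
  shows "the_inv_into (carrier M) f \<in> lmod_hom R N M"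
proof (rule lmod_homI)
  interpret M: left_module R M by fact
  let ?g = "the_inv_into (carrier M) f"
  have inj: "inj_on f (carrier M)" and im: "f ` carrier M = carrier N"
    using bij by (auto simp: bij_betw_def)
  have g: "?g y \<in> carrier M" "f (?g y) = y" if "y \<in> carrier N" for y
    using that inj im by (auto intro: the_inv_into_into f_the_inv_into_f)
  have gf: "?g (f x) = x" if "x \<in> carrier M" for x
    using inj that by (rule the_inv_into_f_f)
  show "?g y \<in> carrier M" if "y \<in> carrier N" for y using g that by simp
  fix y assume y: "y \<in> carrier N"
  show "?g (y \<oplus>\<^bsub>N\<^esub> z) = ?g y \<oplus>\<^bsub>M\<^esub> ?g z" if z: "z \<in> carrier N" for z
    using gf[of "?g y \<oplus>\<^bsub>M\<^esub> ?g z"] g[OF y] g[OF z] by (simp add: lmod_hom_add[OF f])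
  show "?g (a \<odot>\<^bsub>N\<^esub> y) = a \<odot>\<^bsub>M\<^esub> ?g y" if a: "a \<in> carrier R" for a
    using gf[of "a \<odot>\<^bsub>M\<^esub> ?g y"] g[OF y] a by (simp add: lmod_hom_smult[OF f])
qed

text \<open>
  The unit vectors of the free module, projected to the summand, and the coordinates restricted to it.
\<close>

lemma projective_imp_dual_basis:
  fixes P :: "('r, 'm) module"
  assumes "projective_module R P"
  obtains X :: "'m set" and b c where "dual_basis R P X b c"
proof -
  obtain Q :: "('r, 'm \<Rightarrow> 'r) module" and X :: "'m set" and f
    where P: "left_module R P" and Q: "left_module R Q"
      and f: "f \<in> lmod_hom R (direct_sum_module P Q) (free_module R X)"
      and bij: "bij_betw f (carrier (direct_sum_module P Q)) (carrier (free_module R X))"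
    using assms unfolding projective_module_def lmod_isomorphic_def by blast
  interpret P: left_module R P by fact
  interpret Q: left_module R Q by fact
  let ?S = "direct_sum_module P Q" and ?F = "free_module R X"
  let ?g = "the_inv_into (carrier ?S) f"
  have S: "left_module R ?S" using direct_sum_left_module[OF P Q] .
  have F: "left_module R ?F" by (rule P.R.free_left_module)
  have "fst \<in> lmod_hom R ?S P" by (rule lmod_homI) (auto simp: direct_sum_module_def)
  then have p: "fst \<circ> ?g \<in> lmod_hom R ?F P"
    by (rule lmod_hom_comp[OF lmod_hom_inverse[OF f S bij]])
  have "(\<lambda>x. (x, \<zero>\<^bsub>Q\<^esub>)) \<in> lmod_hom R P ?S"
    by (rule lmod_homI) (auto simp: direct_sum_module_def)
  then have i: "f \<circ> (\<lambda>x. (x, \<zero>\<^bsub>Q\<^esub>)) \<in> lmod_hom R P ?F" by (rule lmod_hom_comp[OF _ f])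
  have uv: "unit_vector R \<in> X \<rightarrow> carrier ?F" using P.R.unit_vector_closed by auto
  have "dual_basis R P X ((fst \<circ> ?g) \<circ> unit_vector R) (f \<circ> (\<lambda>x. (x, \<zero>\<^bsub>Q\<^esub>)))"
    unfolding dual_basis_def
  proof (intro conjI ballI i)
    show "(fst \<circ> ?g) \<circ> unit_vector R \<in> X \<rightarrow> carrier P"
      using uv p by (auto simp: lmod_hom_def)
    fix x assume x: "x \<in> carrier P"
    let ?u = "f (x, \<zero>\<^bsub>Q\<^esub>)"
    have u: "?u \<in> carrier ?F" using lmod_hom_closed[OF i x] by simp
    have "lincomb R P ((fst \<circ> ?g) \<circ> unit_vector R) ?u = (fst \<circ> ?g) (lincomb R ?F (unit_vector R) ?u)"
      using lmod_hom_lincomb[OF F P p uv u] by simp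
    also have "\<dots> = (fst \<circ> ?g) ?u" by (simp add: P.R.lincomb_unit_vectors[OF u])
    also have "\<dots> = x"
      using bij x by (auto simp: bij_betw_def the_inv_into_f_f direct_sum_module_def)
    finally show "lincomb R P ((fst \<circ> ?g) \<circ> unit_vector R) ((f \<circ> (\<lambda>x. (x, \<zero>\<^bsub>Q\<^esub>))) x) = x" by simp
  qed
  then show thesis by (rule that)
qed

text \<open>
  A dual basis splits every surjection onto \<open>P\<close>, in particular the canonical one from the free module
  on the set \<open>carrier P\<close>; its kernel is a complement of the type that \<^const>\<open>projective_module\<close> asks for.
\<close>

lemma dual_basis_imp_projective:
  fixes P :: "('r, 'm) module"
  assumes P: "left_module R P" and db: "dual_basis R P Y b c"
  shows "projective_module R P"
proof -
  interpret P: left_module R P by fact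
  let ?X = "carrier P"
  let ?F = "free_module R ?X"
  interpret F: left_module R ?F by (rule P.R.free_left_module)
  have b: "b \<in> Y \<rightarrow> carrier P" and c: "c \<in> lmod_hom R P (free_module R Y)"
    and bc: "\<And>x. x \<in> carrier P \<Longrightarrow> lincomb R P b (c x) = x"
    using db by (auto simp: dual_basis_def)
  define \<pi> where "\<pi> = lincomb R P id"
  define \<sigma> where "\<sigma> = lincomb R ?F (unit_vector R \<circ> b) \<circ> c"
  have \<pi>: "\<pi> \<in> lmod_hom R ?F P" unfolding \<pi>_def by (rule P.lincomb_lmod_hom) simp
  have ub: "unit_vector R \<circ> b \<in> Y \<rightarrow> carrier ?F"
    using b by (auto intro!: P.R.unit_vector_closed)
  have \<sigma>: "\<sigma> \<in> lmod_hom R P ?F"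
    unfolding \<sigma>_def by (rule lmod_hom_comp[OF c F.lincomb_lmod_hom[OF ub]])
  have \<pi>\<sigma>: "\<pi> (\<sigma> x) = x" if x: "x \<in> carrier P" for x
  proof -
    have cx: "c x \<in> carrier (free_module R Y)" using c x by (rule lmod_hom_closed)
    have *: "(\<pi> \<circ> (unit_vector R \<circ> b)) y = b y" if "y \<in> Y" for y
      using P.lincomb_unit_vector[of id ?X "b y"] that b by (auto simp: \<pi>_def)
    have "\<pi> (\<sigma> x) = lincomb R P (\<pi> \<circ> (unit_vector R \<circ> b)) (c x)"
      unfolding \<sigma>_def using lmod_hom_lincomb[OF F.left_module_axioms P \<pi> ub cx] by simp
    also have "\<dots> = lincomb R P b (c x)"
      unfolding lincomb_def
    proof (rule P.finsum_cong')
      fix y assume "y \<in> {y. c x y \<noteq> \<zero>\<^bsub>R\<^esub>}"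
      then have "y \<in> Y" using cx by (auto simp: free_module_carrier)
      then show "c x y \<odot>\<^bsub>P\<^esub> (\<pi> \<circ> (unit_vector R \<circ> b)) y = c x y \<odot>\<^bsub>P\<^esub> b y" by (simp only: *)
    next
      show "(\<lambda>y. c x y \<odot>\<^bsub>P\<^esub> b y) \<in> {y. c x y \<noteq> \<zero>\<^bsub>R\<^esub>} \<rightarrow> carrier P"
        using b cx by (auto simp: free_module_carrier Pi_def)
    qed simp
    finally show ?thesis using bc[OF x] by simp
  qed
  define Q where "Q = ?F\<lparr>carrier := {u \<in> carrier ?F. \<pi> u = \<zero>\<^bsub>P\<^esub>}\<rparr>"
  have Q: "left_module R Q"
    unfolding Q_def
    by (rule F.submodule_left_module)
      (use lmod_hom_zero[OF F.is_abelian_group P.is_abelian_group \<pi>]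
          lmod_hom_minus[OF F.is_abelian_group P.is_abelian_group \<pi>] in \<open>auto simp: lmod_homD[OF \<pi>]\<close>)
  define h where "h = (\<lambda>x. \<sigma> (fst x) \<oplus>\<^bsub>?F\<^esub> snd x)"
  have "h \<in> lmod_hom R (direct_sum_module P Q) ?F"
  proof (rule lmod_homI)
    fix x y assume "x \<in> carrier (direct_sum_module P Q)" "y \<in> carrier (direct_sum_module P Q)"
    then have xy: "fst x \<in> carrier P" "fst y \<in> carrier P" "snd x \<in> carrier ?F" "snd y \<in> carrier ?F"
      "\<sigma> (fst x) \<in> carrier ?F" "\<sigma> (fst y) \<in> carrier ?F"
      by (auto simp: direct_sum_module_def Q_def lmod_homD[OF \<sigma>])
    then show "h (x \<oplus>\<^bsub>direct_sum_module P Q\<^esub> y) = h x \<oplus>\<^bsub>?F\<^esub> h y"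
      unfolding h_def
      by (simp add: direct_sum_module_def lmod_homD[OF \<sigma>] Q_def F.a_ac)
  qed (auto simp: direct_sum_module_def Q_def h_def lmod_homD[OF \<sigma>] F.smult_r_distr)
  moreover have "bij_betw h (carrier (direct_sum_module P Q)) (carrier ?F)"
  proof (rule bij_betwI[where g = "\<lambda>u. (\<pi> u, u \<ominus>\<^bsub>?F\<^esub> \<sigma> (\<pi> u))"])
    have \<pi>h: "\<pi> (h x) = fst x" if "x \<in> carrier (direct_sum_module P Q)" for x
      using that by (auto simp: h_def direct_sum_module_def Q_def lmod_homD[OF \<pi>] lmod_homD[OF \<sigma>] \<pi>\<sigma>)
    show "h \<in> carrier (direct_sum_module P Q) \<rightarrow> carrier ?F"
      by (auto simp: direct_sum_module_def Q_def h_def lmod_homD[OF \<sigma>])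
    show "(\<lambda>u. (\<pi> u, u \<ominus>\<^bsub>?F\<^esub> \<sigma> (\<pi> u))) \<in> carrier ?F \<rightarrow> carrier (direct_sum_module P Q)"
      using lmod_hom_minus[OF F.is_abelian_group P.is_abelian_group \<pi>]
      by (auto simp: direct_sum_module_def Q_def lmod_homD[OF \<sigma>] lmod_homD[OF \<pi>] F.minus_eq \<pi>\<sigma> P.r_neg)
    show "(\<pi> (h x), h x \<ominus>\<^bsub>?F\<^esub> \<sigma> (\<pi> (h x))) = x" if x: "x \<in> carrier (direct_sum_module P Q)" for x
    proof -
      have "\<sigma> (fst x) \<in> carrier ?F" "snd x \<in> carrier ?F"
        using x by (auto simp: direct_sum_module_def Q_def lmod_homD[OF \<sigma>])
      then have "h x \<ominus>\<^bsub>?F\<^esub> \<sigma> (fst x) = snd x"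
        unfolding h_def F.minus_eq
        by (metis F.a_comm F.a_inv_closed F.add.m_assoc F.r_neg F.r_zero)
      then show ?thesis using \<pi>h[OF x] by simp
    qed
    show "h (\<pi> u, u \<ominus>\<^bsub>?F\<^esub> \<sigma> (\<pi> u)) = u" if u: "u \<in> carrier ?F" for u
    proof -
      have "\<sigma> (\<pi> u) \<in> carrier ?F" using u by (auto simp: lmod_homD[OF \<pi>] lmod_homD[OF \<sigma>])
      then show ?thesis
        unfolding h_def F.minus_eq using u
        by simp (metis F.a_comm F.a_inv_closed F.add.m_assoc F.r_neg F.r_zero)
    qed
  qed
  ultimately have "lmod_isomorphic R (direct_sum_module P Q) ?F"
    unfolding lmod_isomorphic_def by blast
  then show ?thesis unfolding projective_module_def using P Q by blast
qed

lemma dual_basis_retract: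
  assumes M: "left_module R M" and N: "left_module R N" and db: "dual_basis R M X b c"
    and i: "i \<in> lmod_hom R N M" and p: "p \<in> lmod_hom R M N"
    and pi: "\<And>x. x \<in> carrier N \<Longrightarrow> p (i x) = x"
  shows "dual_basis R N X (p \<circ> b) (c \<circ> i)"
proof -
  have b: "b \<in> X \<rightarrow> carrier M" and c: "c \<in> lmod_hom R M (free_module R X)"
    and bc: "\<And>x. x \<in> carrier M \<Longrightarrow> lincomb R M b (c x) = x"
    using db by (auto simp: dual_basis_def)
  have "lincomb R N (p \<circ> b) (c (i x)) = x" if x: "x \<in> carrier N" for x
    using lmod_hom_lincomb[OF M N p b] lmod_hom_closed[OF c] lmod_hom_closed[OF i x] bc pi[OF x]
    by metis
  then show ?thesis
    using lmod_hom_comp[OF i c] b lmod_hom_closed[OF p] by (auto simp: dual_basis_def Pi_def)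
qed

text \<open>
  Only the coordinates that occur in some member of a finite generating set can be nonzero anywhere.
\<close>

lemma finite_dual_basis:
  assumes P: "left_module R P" and fg: "finitely_generated_module R P"
    and db: "dual_basis R P X b c"
  obtains Y where "finite Y" "dual_basis R P Y b c"
proof -
  interpret P: left_module R P by fact
  let ?F = "free_module R X"
  interpret F: left_module R ?F by (rule P.R.free_left_module)
  have b: "b \<in> X \<rightarrow> carrier P" and c: "c \<in> lmod_hom R P ?F"
    and bc: "\<And>x. x \<in> carrier P \<Longrightarrow> lincomb R P b (c x) = x"
    using db by (auto simp: dual_basis_def)
  obtain S where S: "finite S" "S \<subseteq> carrier P"
    and gen: "\<And>x. x \<in> carrier P \<Longrightarrow> \<exists>a\<in>S \<rightarrow> carrier R. x = (\<Oplus>\<^bsub>P\<^esub>s\<in>S. a s \<odot>\<^bsub>P\<^esub> s)"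
    using fg unfolding finitely_generated_module_def by blast
  define Y where "Y = (\<Union>s\<in>S. {y. c s y \<noteq> \<zero>\<^bsub>R\<^esub>})"
  have "finite Y" unfolding Y_def
    using S lmod_hom_closed[OF c] by (auto simp: free_module_carrier)
  have "Y \<subseteq> X" unfolding Y_def using S lmod_hom_closed[OF c] by (auto simp: free_module_carrier)
  have "c x y = \<zero>\<^bsub>R\<^esub>" if x: "x \<in> carrier P" and y: "y \<notin> Y" for x y
  proof -
    obtain a where a: "a \<in> S \<rightarrow> carrier R" and xa: "x = (\<Oplus>\<^bsub>P\<^esub>s\<in>S. a s \<odot>\<^bsub>P\<^esub> s)"
      using gen[OF x] by blast
    have aS: "(\<lambda>s. a s \<odot>\<^bsub>P\<^esub> s) \<in> S \<rightarrow> carrier P" using a S by (auto simp: subset_eq Pi_def)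
    have "c x = (\<Oplus>\<^bsub>?F\<^esub>s\<in>S. c (a s \<odot>\<^bsub>P\<^esub> s))"
      unfolding xa by (rule lmod_hom_finsum[OF P.is_abelian_group F.is_abelian_group c aS])
    then have "c x y = (\<Oplus>\<^bsub>R\<^esub>s\<in>S. c (a s \<odot>\<^bsub>P\<^esub> s) y)"
      using aS lmod_hom_closed[OF c] by (subst (asm) fun_eq_iff) (simp add: P.R.free_finsum_apply Pi_def)
    also have "\<dots> = (\<Oplus>\<^bsub>R\<^esub>s\<in>S. \<zero>\<^bsub>R\<^esub>)"
    proof (rule P.R.finsum_cong')
      fix s assume s: "s \<in> S"
      then have "c s y = \<zero>\<^bsub>R\<^esub>" using y by (auto simp: Y_def)
      moreover have "s \<in> carrier P" "a s \<in> carrier R" using s S a by auto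
      ultimately show "c (a s \<odot>\<^bsub>P\<^esub> s) y = \<zero>\<^bsub>R\<^esub>"
        by (simp add: lmod_hom_smult[OF c] free_module_simps)
    qed auto
    finally show ?thesis by simp
  qed
  then have "c \<in> lmod_hom R P (free_module R Y)"
    using c \<open>Y \<subseteq> X\<close> by (auto simp: lmod_hom_def free_module_simps free_module_carrier Pi_def)
  then have "dual_basis R P Y b c"
    using b bc \<open>Y \<subseteq> X\<close> by (auto simp: dual_basis_def)
  with \<open>finite Y\<close> show thesis by (rule that)
qed

section \<open>Group rings and Novikov modules\<close>

definition delta :: "'g \<Rightarrow> 'g \<Rightarrow> int" where
  "delta g = (\<lambda>x. if x = g then 1 else 0)"

lemma group_ring_simps [simp]:
  "\<zero>\<^bsub>group_ring G\<^esub> = (\<lambda>g. 0)"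
  "r \<oplus>\<^bsub>group_ring G\<^esub> s = (\<lambda>g. r g + s g)"
  "\<one>\<^bsub>group_ring G\<^esub> = delta \<one>\<^bsub>G\<^esub>"
  "r \<otimes>\<^bsub>group_ring G\<^esub> s = series_mult G r s"
  by (simp_all add: group_ring_def series_ring_def delta_def)

lemma group_ring_carrier:
  "r \<in> carrier (group_ring G) \<longleftrightarrow> (\<forall>g. r g \<noteq> 0 \<longrightarrow> g \<in> carrier G) \<and> finite {g. r g \<noteq> 0}"
proof -
  have "finite {g. r g \<noteq> 0} \<longleftrightarrow> finite {g \<in> carrier G. r g \<noteq> 0}"
    if "\<forall>g. r g \<noteq> 0 \<longrightarrow> g \<in> carrier G"
    by (rule arg_cong[where f = finite]) (use that in auto)
  then show ?thesis by (auto simp: group_ring_def series_ring_def)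
qed

lemma novikov_module_simps [simp]:
  "\<zero>\<^bsub>novikov_module G \<chi>\<^esub> = (\<lambda>g. 0)"
  "r \<oplus>\<^bsub>novikov_module G \<chi>\<^esub> s = (\<lambda>g. r g + s g)"
  "r \<odot>\<^bsub>novikov_module G \<chi>\<^esub> s = series_mult G r s"
  by (simp_all add: novikov_module_def novikov_ring_def series_ring_def
      ring.defs module.defs)

lemma novikov_module_carrier:
  "r \<in> carrier (novikov_module G \<chi>) \<longleftrightarrow> (\<forall>g. r g \<noteq> 0 \<longrightarrow> g \<in> carrier G) \<and>
     (\<forall>t::real. finite {g. r g \<noteq> 0 \<and> \<chi> g \<le> t})"
proof -
  have "finite {g. r g \<noteq> 0 \<and> \<chi> g \<le> t} \<longleftrightarrow> finite {g \<in> carrier G. r g \<noteq> 0 \<and> \<chi> g \<le> t}"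
    if "\<forall>g. r g \<noteq> 0 \<longrightarrow> g \<in> carrier G" for t
    by (rule arg_cong[where f = finite]) (use that in auto)
  then show ?thesis
    by (auto simp: novikov_module_def novikov_ring_def series_ring_def ring.defs module.defs)
qed

lemma novikov_abelian_group: "abelian_group (novikov_module G \<chi>)"
proof (rule abelian_groupI)
  fix r s assume rs: "r \<in> carrier (novikov_module G \<chi>)" "s \<in> carrier (novikov_module G \<chi>)"
  have "finite {g. r g + s g \<noteq> 0 \<and> \<chi> g \<le> t}" for t
    by (rule finite_subset[of _ "{g. r g \<noteq> 0 \<and> \<chi> g \<le> t} \<union> {g. s g \<noteq> 0 \<and> \<chi> g \<le> t}"])
      (use rs in \<open>auto simp: novikov_module_carrier\<close>)
  moreover have "g \<in> carrier G" if "r g + s g \<noteq> 0" for g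
    using that rs unfolding novikov_module_carrier by (metis add_0)
  ultimately show "r \<oplus>\<^bsub>novikov_module G \<chi>\<^esub> s \<in> carrier (novikov_module G \<chi>)"
    by (simp add: novikov_module_carrier)
next
  fix r assume "r \<in> carrier (novikov_module G \<chi>)"
  then show "\<exists>s\<in>carrier (novikov_module G \<chi>).
      s \<oplus>\<^bsub>novikov_module G \<chi>\<^esub> r = \<zero>\<^bsub>novikov_module G \<chi>\<^esub>"
    by (intro bexI[of _ "\<lambda>g. - r g"]) (auto simp: novikov_module_carrier)
qed (auto simp: novikov_module_carrier)

lemma group_ring_subset_novikov:
  "carrier (group_ring G) \<subseteq> carrier (novikov_module G \<chi>)"
  by (auto simp: group_ring_carrier novikov_module_carrier elim: rev_finite_subset)

lemma series_mult_nonzeroE: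
  assumes "series_mult G r w g \<noteq> 0"
  obtains h k where "h \<in> carrier G" "k \<in> carrier G" "h \<otimes>\<^bsub>G\<^esub> k = g" "r h \<noteq> 0" "w k \<noteq> 0"
proof -
  have "\<exists>p\<in>{(h, k). h \<in> carrier G \<and> k \<in> carrier G \<and> h \<otimes>\<^bsub>G\<^esub> k = g \<and> r h \<noteq> 0 \<and> w k \<noteq> 0}.
      (\<lambda>(h, k). r h * w k) p \<noteq> 0"
    using assms unfolding series_mult_def by (meson sum.neutral)
  then show thesis using that by auto
qed

lemma group_ring_add_closed:
  assumes "r \<in> carrier (group_ring G)" "s \<in> carrier (group_ring G)"
  shows "(\<lambda>g. r g + s g) \<in> carrier (group_ring G)"
proof -
  have "finite {g. r g + s g \<noteq> 0}"
    by (rule finite_subset[of _ "{g. r g \<noteq> 0} \<union> {g. s g \<noteq> 0}"])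
      (use assms in \<open>auto simp: group_ring_carrier\<close>)
  moreover have "g \<in> carrier G" if "r g + s g \<noteq> 0" for g
    using that assms unfolding group_ring_carrier by (metis add_0)
  ultimately show ?thesis by (simp add: group_ring_carrier)
qed

lemma group_ring_minus_closed:
  "r \<in> carrier (group_ring G) \<Longrightarrow> (\<lambda>g. - r g) \<in> carrier (group_ring G)"
  by (simp add: group_ring_carrier)

lemma group_ring_zero_closed: "(\<lambda>g. 0) \<in> carrier (group_ring G)"
  by (simp add: group_ring_carrier)

lemma delta_closed: "g \<in> carrier G \<Longrightarrow> delta g \<in> carrier (group_ring G)"
  by (auto simp: group_ring_carrier delta_def)

text \<open>
  The elements of \<open>G\<close> generate the group ring as an abelian group. The induction is on the sum of
  the absolute values of the coefficients, removing one group element with sign at a time.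
\<close>

lemma group_ring_induct [consumes 1, case_names zero delta add minus]:
  assumes "r \<in> carrier (group_ring G)"
    and "P (\<lambda>g. 0)" and "\<And>g. g \<in> carrier G \<Longrightarrow> P (delta g)"
    and "\<And>r s. r \<in> carrier (group_ring G) \<Longrightarrow> s \<in> carrier (group_ring G) \<Longrightarrow> P r \<Longrightarrow> P s \<Longrightarrow>
      P (\<lambda>g. r g + s g)"
    and "\<And>r. r \<in> carrier (group_ring G) \<Longrightarrow> P r \<Longrightarrow> P (\<lambda>g. - r g)"
  shows "P r"
  using assms(1)
proof (induction "\<Sum>g | r g \<noteq> 0. nat \<bar>r g\<bar>" arbitrary: r rule: less_induct)
  case less
  show ?case
  proof (cases "r = (\<lambda>g. 0)")
    case True
    then show ?thesis using assms(2) by simp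
  next
    case False
    then obtain a where a: "r a \<noteq> 0" by auto
    then have aG: "a \<in> carrier G" using less.prems by (simp add: group_ring_carrier)
    define e where "e = (\<lambda>g. if g = a then sgn (r a) else 0)"
    define s where "s = (\<lambda>g. r g + - e g)"
    have e: "e \<in> carrier (group_ring G) \<and> P e"
    proof (cases "r a > 0")
      case True
      then have "e = delta a" by (auto simp: e_def delta_def)
      then show ?thesis using assms(3) aG delta_closed by metis
    next
      case False
      then have "e = (\<lambda>g. - delta a g)" using a by (auto simp: e_def delta_def)
      then show ?thesis using assms(3,5) aG delta_closed group_ring_minus_closed by metis
    qed
    have s: "s \<in> carrier (group_ring G)"
      unfolding s_def using less.prems e group_ring_add_closed group_ring_minus_closed by blast
    have fin: "finite {g. r g \<noteq> 0}" using less.prems by (simp add: group_ring_carrier)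
    have "(\<Sum>g | s g \<noteq> 0. nat \<bar>s g\<bar>) \<le> (\<Sum>g | r g \<noteq> 0. nat \<bar>s g\<bar>)"
      by (rule sum_mono2[OF fin]) (auto simp: s_def e_def a)
    also have "\<dots> < (\<Sum>g | r g \<noteq> 0. nat \<bar>r g\<bar>)"
    proof (rule sum_strict_mono_ex1[OF fin])
      show "\<forall>g\<in>{g. r g \<noteq> 0}. nat \<bar>s g\<bar> \<le> nat \<bar>r g\<bar>"
        by (auto simp: s_def e_def sgn_if abs_if)
      show "\<exists>g\<in>{g. r g \<noteq> 0}. nat \<bar>s g\<bar> < nat \<bar>r g\<bar>"
        using a by (intro bexI[of _ a]) (auto simp: s_def e_def sgn_if abs_if)
    qed
    finally have "P s" using less.hyps s by blast
    then have "P (\<lambda>g. s g + e g)" using assms(4) s e by blast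
    then show ?thesis by (simp add: s_def)
  qed
qed

context group
begin

text \<open>
  The second factor \<open>w\<close> is an arbitrary function, so this covers both the product of the group ring and
  its action on a Novikov module.
\<close>

lemma series_mult_eq_sum:
  assumes "finite A" "A \<subseteq> carrier G" "{h. r h \<noteq> 0} \<subseteq> A" "g \<in> carrier G"
  shows "series_mult G r w g = (\<Sum>h\<in>A. r h * w (inv h \<otimes> g))"
proof -
  let ?A = "{h \<in> A. r h \<noteq> 0 \<and> w (inv h \<otimes> g) \<noteq> 0}"
  have "(\<Sum>h\<in>A. r h * w (inv h \<otimes> g)) = (\<Sum>h\<in>?A. r h * w (inv h \<otimes> g))"
    by (rule sum.mono_neutral_right) (use assms in auto)
  also have "\<dots> = series_mult G r w g"
    unfolding series_mult_def
  proof (rule sum.reindex_bij_witness[of _ fst "\<lambda>h. (h, inv h \<otimes> g)"])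
    fix h assume "h \<in> ?A"
    then show "(h, inv h \<otimes> g) \<in> {(h, k). h \<in> carrier G \<and> k \<in> carrier G \<and> h \<otimes> k = g \<and> r h \<noteq> 0 \<and> w k \<noteq> 0}"
      using assms by (auto simp: m_assoc[symmetric] subset_eq)
  next
    fix p assume "p \<in> {(h, k). h \<in> carrier G \<and> k \<in> carrier G \<and> h \<otimes> k = g \<and> r h \<noteq> 0 \<and> w k \<noteq> 0}"
    then show "(fst p, inv (fst p) \<otimes> g) = p" "fst p \<in> ?A"
      using assms by (auto simp: m_assoc[symmetric])
  qed auto
  finally show ?thesis by simp
qed

lemma series_mult_outside: "g \<notin> carrier G \<Longrightarrow> series_mult G r w g = 0"
  by (metis m_closed series_mult_nonzeroE)

lemma series_mult_group_ring:
  assumes "r \<in> carrier (group_ring G)"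
  shows "series_mult G r w g = (if g \<in> carrier G then \<Sum>h | r h \<noteq> 0. r h * w (inv h \<otimes> g) else 0)"
  using assms series_mult_eq_sum[of "{h. r h \<noteq> 0}" r g w] series_mult_outside
  by (auto simp: group_ring_carrier)

lemma series_mult_zero_left: "series_mult G (\<lambda>g. 0) w = (\<lambda>g. 0)"
  by (simp add: series_mult_def)

lemma series_mult_delta:
  assumes "g \<in> carrier G"
  shows "series_mult G (delta g) w x = (if x \<in> carrier G then w (inv g \<otimes> x) else 0)"
  using series_mult_eq_sum[of "{g}" "delta g" x w] assms series_mult_outside
  by (auto simp: delta_def)

lemma series_mult_add_left:
  assumes "r \<in> carrier (group_ring G)" "s \<in> carrier (group_ring G)"
  shows "series_mult G (\<lambda>g. r g + s g) w = (\<lambda>g. series_mult G r w g + series_mult G s w g)"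
proof
  fix g
  let ?A = "{h. r h \<noteq> 0} \<union> {h. s h \<noteq> 0}"
  have A: "finite ?A" "?A \<subseteq> carrier G" "{h. r h + s h \<noteq> 0} \<subseteq> ?A"
    using assms by (auto simp: group_ring_carrier)
  show "series_mult G (\<lambda>g. r g + s g) w g = series_mult G r w g + series_mult G s w g"
  proof (cases "g \<in> carrier G")
    case True
    then show ?thesis
      using series_mult_eq_sum[OF A, of g w] series_mult_eq_sum[OF A(1,2) _ True, of r w]
        series_mult_eq_sum[OF A(1,2) _ True, of s w]
      by (simp add: sum.distrib algebra_simps)
  qed (simp add: series_mult_outside)
qed

lemma series_mult_minus_left:
  assumes "r \<in> carrier (group_ring G)"
  shows "series_mult G (\<lambda>g. - r g) w = (\<lambda>g. - series_mult G r w g)"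
  using assms group_ring_minus_closed[OF assms]
  by (auto simp: series_mult_group_ring sum_negf)

lemma series_mult_add_right:
  assumes "r \<in> carrier (group_ring G)"
  shows "series_mult G r (\<lambda>g. v g + w g) = (\<lambda>g. series_mult G r v g + series_mult G r w g)"
  using assms by (auto simp: series_mult_group_ring sum.distrib algebra_simps)

lemma series_mult_delta_right:
  assumes "r \<in> carrier (group_ring G)" "t \<in> carrier G" "g \<in> carrier G"
  shows "series_mult G r (delta t) g = r (g \<otimes> inv t)"
proof -
  have *: "inv h \<otimes> g = t \<longleftrightarrow> h = g \<otimes> inv t" if "h \<in> carrier G" for h
    using that assms by (metis inv_closed inv_equality inv_solve_left inv_solve_right m_closed)
  have "series_mult G r (delta t) g = (\<Sum>h | r h \<noteq> 0. r h * delta t (inv h \<otimes> g))"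
    using assms by (simp add: series_mult_group_ring)
  also have "\<dots> = (\<Sum>h | r h \<noteq> 0. if h = g \<otimes> inv t then r h else 0)"
    by (rule sum.cong) (use * assms in \<open>auto simp: delta_def group_ring_carrier\<close>)
  also have "\<dots> = r (g \<otimes> inv t)" using assms by (simp add: group_ring_carrier)
  finally show ?thesis .
qed

lemma series_mult_closed:
  assumes "r \<in> carrier (group_ring G)" "s \<in> carrier (group_ring G)"
  shows "series_mult G r s \<in> carrier (group_ring G)"
proof -
  have "finite {g. series_mult G r s g \<noteq> 0}"
    by (rule finite_subset[of _ "(\<lambda>(h, k). h \<otimes> k) ` ({h. r h \<noteq> 0} \<times> {k. s k \<noteq> 0})"])
      (use assms in \<open>auto simp: group_ring_carrier elim!: series_mult_nonzeroE\<close>)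
  then show ?thesis
    by (auto simp: group_ring_carrier elim!: series_mult_nonzeroE)
qed

text \<open>
  By additivity in \<open>r\<close> it suffices to treat a group element, where multiplication is translation.
\<close>

lemma series_mult_assoc:
  assumes r: "r \<in> carrier (group_ring G)" and s: "s \<in> carrier (group_ring G)"
  shows "series_mult G (series_mult G r s) w = series_mult G r (series_mult G s w)"
  using r
proof (induction r rule: group_ring_induct)
  case (delta a)
  show ?case
  proof
    fix x
    show "series_mult G (series_mult G (delta a) s) w x = series_mult G (delta a) (series_mult G s w) x"
    proof (cases "x \<in> carrier G")
      case x: True
      let ?S = "{h. s h \<noteq> 0}"
      have S: "finite ?S" "?S \<subseteq> carrier G" using s by (auto simp: group_ring_carrier)
      have sub: "{h. series_mult G (delta a) s h \<noteq> 0} \<subseteq> (\<lambda>h. a \<otimes> h) ` ?S"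
      proof
        fix h assume "h \<in> {h. series_mult G (delta a) s h \<noteq> 0}"
        then have "h \<in> carrier G" "s (inv a \<otimes> h) \<noteq> 0"
          using delta by (auto simp: series_mult_delta split: if_splits)
        then show "h \<in> (\<lambda>h. a \<otimes> h) ` ?S"
          using delta by (intro image_eqI[of _ _ "inv a \<otimes> h"]) (auto simp: m_assoc[symmetric])
      qed
      have "series_mult G (series_mult G (delta a) s) w x =
          (\<Sum>h\<in>(\<lambda>h. a \<otimes> h) ` ?S. series_mult G (delta a) s h * w (inv h \<otimes> x))"
        by (rule series_mult_eq_sum) (use S sub x delta in auto)
      also have "\<dots> = (\<Sum>h\<in>?S. series_mult G (delta a) s (a \<otimes> h) * w (inv (a \<otimes> h) \<otimes> x))"
        by (subst sum.reindex) (use S delta in \<open>auto intro!: inj_onI simp: subset_eq\<close>)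
      also have "\<dots> = (\<Sum>h\<in>?S. s h * w (inv h \<otimes> (inv a \<otimes> x)))"
        by (rule sum.cong)
          (use S delta x in \<open>auto simp: series_mult_delta m_assoc[symmetric] inv_mult_group subset_eq\<close>)
      also have "\<dots> = series_mult G (delta a) (series_mult G s w) x"
        using delta x s by (simp add: series_mult_delta series_mult_group_ring)
      finally show ?thesis .
    qed (simp add: series_mult_outside)
  qed
qed (use s series_mult_closed in \<open>simp_all add: series_mult_zero_left series_mult_add_left series_mult_minus_left\<close>)

lemma group_ring_ring: "ring (group_ring G)"
proof (rule ringI)
  show "abelian_group (group_ring G)"
  proof (rule abelian_groupI)
    fix r assume "r \<in> carrier (group_ring G)"
    then show "\<exists>s\<in>carrier (group_ring G). s \<oplus>\<^bsub>group_ring G\<^esub> r = \<zero>\<^bsub>group_ring G\<^esub>"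
      by (intro bexI[of _ "\<lambda>g. - r g"]) (auto simp: group_ring_minus_closed)
  qed (auto simp: group_ring_zero_closed intro: group_ring_add_closed)
  have "series_mult G (delta \<one>) r = r" if "r \<in> carrier (group_ring G)" for r
    using that by (auto simp: series_mult_delta fun_eq_iff group_ring_carrier)
  moreover have "series_mult G r (delta \<one>) = r" if r: "r \<in> carrier (group_ring G)" for r
  proof
    fix g show "series_mult G r (delta \<one>) g = r g"
      using series_mult_delta_right[OF r one_closed, of g] r series_mult_outside[of g r]
      by (cases "g \<in> carrier G") (auto simp: group_ring_carrier)
  qed
  ultimately show "monoid (group_ring G)"
    by (intro monoidI) (auto simp: series_mult_closed series_mult_assoc delta_closed)
qed (auto simp: series_mult_add_left series_mult_add_right)

lemma group_ring_a_inv: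
  assumes "r \<in> carrier (group_ring G)"
  shows "\<ominus>\<^bsub>group_ring G\<^esub> r = (\<lambda>g. - r g)"
proof -
  interpret ring "group_ring G" by (rule group_ring_ring)
  show ?thesis by (rule minus_equality) (use assms group_ring_minus_closed in auto)
qed

lemma group_ring_finsum_apply:
  assumes "f \<in> A \<rightarrow> carrier (group_ring G)" "finite A"
  shows "(\<Oplus>\<^bsub>group_ring G\<^esub>i\<in>A. f i) g = (\<Sum>i\<in>A. f i g)"
proof -
  interpret ring "group_ring G" by (rule group_ring_ring)
  show ?thesis using assms(2,1) by (induction A rule: finite_induct) auto
qed

text \<open>
  Since the elements of the group generate the group ring additively, an additive map into a
  Novikov module is linear as soon as it commutes with translations.
\<close>

lemma translation_equivariant_imp_linear:
  assumes M: "left_module (group_ring G) M"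
    and f: "f \<in> carrier M \<rightarrow> carrier (novikov_module G \<chi>)"
    and add: "\<And>x y. x \<in> carrier M \<Longrightarrow> y \<in> carrier M \<Longrightarrow> f (x \<oplus>\<^bsub>M\<^esub> y) = (\<lambda>g. f x g + f y g)"
    and equi: "\<And>h g x. h \<in> carrier G \<Longrightarrow> g \<in> carrier G \<Longrightarrow> x \<in> carrier M \<Longrightarrow>
      f (delta h \<odot>\<^bsub>M\<^esub> x) g = f x (inv h \<otimes> g)"
  shows "f \<in> lmod_hom (group_ring G) M (novikov_module G \<chi>)"
proof (rule lmod_homI)
  interpret M: left_module "group_ring G" M by fact
  fix r x assume r: "r \<in> carrier (group_ring G)" and x: "x \<in> carrier M"
  have f0: "f \<zero>\<^bsub>M\<^esub> = (\<lambda>g. 0)" using add[of "\<zero>\<^bsub>M\<^esub>" "\<zero>\<^bsub>M\<^esub>"] by (auto simp: fun_eq_iff)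
  have fm: "f (\<ominus>\<^bsub>M\<^esub> y) = (\<lambda>g. - f y g)" if "y \<in> carrier M" for y
  proof
    fix g show "f (\<ominus>\<^bsub>M\<^esub> y) g = - f y g"
      using add[of "\<ominus>\<^bsub>M\<^esub> y" y] that f0 by (simp add: M.M.l_neg fun_eq_iff) (metis add_eq_0_iff2)
  qed
  have "f (r \<odot>\<^bsub>M\<^esub> x) = series_mult G r (f x)"
    using r
  proof (induction r rule: group_ring_induct)
    case zero
    show ?case using M.smult_zero_left[OF x] f0 by (simp add: series_mult_zero_left)
  next
    case (delta h)
    show ?case
    proof
      fix g
      have "delta h \<odot>\<^bsub>M\<^esub> x \<in> carrier M" using delta_closed[OF delta] x by simp
      then have "f (delta h \<odot>\<^bsub>M\<^esub> x) \<in> carrier (novikov_module G \<chi>)" using f by auto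
      then show "f (delta h \<odot>\<^bsub>M\<^esub> x) g = series_mult G (delta h) (f x) g"
        using equi[OF delta _ x, of g] delta by (auto simp: series_mult_delta novikov_module_carrier)
    qed
  next
    case (add r s)
    then show ?case
      using M.smult_l_distr[of r s x] x assms(3)[of "r \<odot>\<^bsub>M\<^esub> x" "s \<odot>\<^bsub>M\<^esub> x"]
      by (simp add: series_mult_add_left)
  next
    case (minus r)
    then show ?case
      using M.smult_minus_left[of r x] x fm[of "r \<odot>\<^bsub>M\<^esub> x"]
      by (simp add: group_ring_a_inv series_mult_minus_left)
  qed
  then show "f (r \<odot>\<^bsub>M\<^esub> x) = r \<odot>\<^bsub>novikov_module G \<chi>\<^esub> f x" by simp
qed (use f add in auto)

end

section \<open>Cohomology in the top degree\<close>

lemma hom_group_comm_group: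
  fixes M :: "('r, 'm) module" and N :: "('r, 'n) module"
  assumes M: "left_module R M" and N: "left_module R N"
  shows "comm_group (hom_group R M N)"
proof -
  interpret M: left_module R M by fact
  interpret N: left_module R N by fact
  let ?H = "hom_group R M N"
  have carr: "f \<in> carrier ?H \<longleftrightarrow> f \<in> lmod_hom R M N \<and> f \<in> extensional (carrier M)" for f
    by (simp add: hom_group_def)
  have restr: "restrict f (carrier M) \<in> carrier ?H" if "f \<in> lmod_hom R M N" for f
    using that by (auto simp: carr lmod_hom_def)
  have mult: "f \<otimes>\<^bsub>?H\<^esub> g = (\<lambda>x\<in>carrier M. f x \<oplus>\<^bsub>N\<^esub> g x)" for f g by (simp add: hom_group_def)
  have one: "\<one>\<^bsub>?H\<^esub> = (\<lambda>x\<in>carrier M. \<zero>\<^bsub>N\<^esub>)" by (simp add: hom_group_def)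
  have ext: "f = g" if "f \<in> extensional (carrier M)" "g \<in> extensional (carrier M)"
    "\<And>x. x \<in> carrier M \<Longrightarrow> f x = g x" for f g :: "'m \<Rightarrow> 'n"
    using that by (rule extensionalityI)
  show ?thesis
  proof (rule comm_groupI)
    fix f assume f: "f \<in> carrier ?H"
    show "\<exists>g\<in>carrier ?H. g \<otimes>\<^bsub>?H\<^esub> f = \<one>\<^bsub>?H\<^esub>"
    proof (rule bexI)
      show "restrict (\<lambda>x. \<ominus>\<^bsub>N\<^esub> f x) (carrier M) \<in> carrier ?H"
        using f by (intro restr N.minus_lmod_hom) (simp add: carr)
      show "restrict (\<lambda>x. \<ominus>\<^bsub>N\<^esub> f x) (carrier M) \<otimes>\<^bsub>?H\<^esub> f = \<one>\<^bsub>?H\<^esub>"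
        unfolding mult one by (rule restrict_ext) (use f in \<open>auto simp: carr lmod_homD N.M.l_neg\<close>)
    qed
    show "\<one>\<^bsub>?H\<^esub> \<otimes>\<^bsub>?H\<^esub> f = f"
      unfolding mult one by (rule ext) (use f in \<open>auto simp: carr lmod_homD\<close>)
  next
    fix f g assume f: "f \<in> carrier ?H" and g: "g \<in> carrier ?H"
    show "f \<otimes>\<^bsub>?H\<^esub> g \<in> carrier ?H"
      unfolding mult by (intro restr N.add_lmod_hom) (use f g in \<open>auto simp: carr\<close>)
    show "f \<otimes>\<^bsub>?H\<^esub> g = g \<otimes>\<^bsub>?H\<^esub> f"
      unfolding mult by (rule restrict_ext) (use f g in \<open>auto simp: carr lmod_homD intro: N.M.a_comm\<close>)
    fix h assume h: "h \<in> carrier ?H"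
    show "f \<otimes>\<^bsub>?H\<^esub> g \<otimes>\<^bsub>?H\<^esub> h = f \<otimes>\<^bsub>?H\<^esub> (g \<otimes>\<^bsub>?H\<^esub> h)"
      unfolding mult by (rule restrict_ext) (use f g h in \<open>auto simp: carr lmod_homD N.M.a_assoc\<close>)
  next
    show "\<one>\<^bsub>?H\<^esub> \<in> carrier ?H" unfolding one by (intro restr N.zero_lmod_hom)
  qed
qed

lemma trivial_quotient_iff:
  assumes "comm_group H" "subgroup B H"
  shows "trivial_group (H Mod B) \<longleftrightarrow> carrier H \<subseteq> B"
proof -
  interpret comm_group H by fact
  interpret B: subgroup B H by fact
  have BN: "B \<lhd> H" using assms(2) by (rule subgroup_imp_normal)
  have grp: "group (H Mod B)" using BN by (rule normal.factorgroup_is_group)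
  have carr: "carrier (H Mod B) = rcosets\<^bsub>H\<^esub> B" "\<one>\<^bsub>H Mod B\<^esub> = B" by (simp_all add: FactGroup_def)
  show ?thesis
  proof
    assume "trivial_group (H Mod B)"
    then have "rcosets\<^bsub>H\<^esub> B = {B}" by (simp add: trivial_group_def carr)
    then have "B #>\<^bsub>H\<^esub> x = B" if "x \<in> carrier H" for x
      using that by (auto simp: RCOSETS_def)
    then show "carrier H \<subseteq> B" using rcos_self[OF _ assms(2)] by blast
  next
    assume "carrier H \<subseteq> B"
    then have "B #>\<^bsub>H\<^esub> x = B" if "x \<in> carrier H" for x
      using that coset_join2[OF that assms(2)] by blast
    then have "rcosets\<^bsub>H\<^esub> B = {B}" by (auto simp: RCOSETS_def)
    then show "trivial_group (H Mod B)" using grp by (simp add: trivial_group_def carr)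
  qed
qed

text \<open>
  In the top degree every cochain is a cocycle, so the cohomology vanishes iff every cochain is a
  coboundary.
\<close>

lemma top_cohomology_trivial_iff:
  fixes C :: "int \<Rightarrow> ('r, 'm) module" and N :: "('r, 'n) module"
  assumes C: "chain_complex R C d" and N: "left_module R N" and top: "zero_module (C (n + 1))"
  shows "trivial_group (cohomology R C d N n) \<longleftrightarrow>
    (\<forall>\<phi>\<in>lmod_hom R (C n) N. \<exists>\<psi>\<in>lmod_hom R (C (n - 1)) N. \<forall>x\<in>carrier (C n). \<phi> x = \<psi> (d n x))"
proof -
  interpret N: left_module R N by fact
  have M: "left_module R (C i)" and dh: "d i \<in> lmod_hom R (C i) (C (i - 1))" for i
    using C by (auto simp: chain_complex_def)
  let ?H = "hom_group R (C n) N" and ?H' = "hom_group R (C (n - 1)) N"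
  have H: "comm_group ?H" and H': "comm_group ?H'" using hom_group_comm_group[OF M N] by auto
  interpret H: comm_group ?H by fact
  interpret H': comm_group ?H' by fact
  have cob: "coboundary C d (n - 1) \<phi> = (\<lambda>x\<in>carrier (C n). \<phi> (d n x))" for \<phi> :: "'m \<Rightarrow> 'n"
    by (simp add: coboundary_def)
  have "coboundary C d n \<phi> = \<one>\<^bsub>hom_group R (C (n + 1)) N\<^esub>" if "\<phi> \<in> carrier ?H" for \<phi>
  proof -
    have \<phi>: "\<phi> \<in> lmod_hom R (C n) N" using that by (simp add: hom_group_def)
    have ab: "abelian_group (C i)" for i using M[of i] by (rule left_module.is_abelian_group)
    have "d (n + 1) \<in> lmod_hom R (C (n + 1)) (C n)" using dh[of "n + 1"] by simp
    then have "d (n + 1) \<zero>\<^bsub>C (n + 1)\<^esub> = \<zero>\<^bsub>C n\<^esub>" by (rule lmod_hom_zero[OF ab ab])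
    then have "\<phi> (d (n + 1) \<zero>\<^bsub>C (n + 1)\<^esub>) = \<zero>\<^bsub>N\<^esub>"
      using lmod_hom_zero[OF ab N.is_abelian_group \<phi>] by simp
    then show ?thesis
      using top unfolding coboundary_def hom_group_def zero_module_def by auto
  qed
  then have ker: "kernel ?H (hom_group R (C (n + 1)) N) (coboundary C d n) = carrier ?H"
    by (auto simp: kernel_def)
  have "group_hom ?H' ?H (coboundary C d (n - 1))"
  proof (intro group_hom.intro group_hom_axioms.intro H.is_group H'.is_group homI)
    fix \<phi> assume "\<phi> \<in> carrier ?H'"
    then have "\<phi> \<circ> d n \<in> lmod_hom R (C n) N"
      by (intro lmod_hom_comp[OF dh]) (simp add: hom_group_def)
    then show "coboundary C d (n - 1) \<phi> \<in> carrier ?H"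
      by (auto simp: cob hom_group_def lmod_hom_def left_module.smult_closed[OF M]
          abelian_groupE[OF left_module.is_abelian_group[OF M]])
  next
    fix \<phi> \<psi> assume "\<phi> \<in> carrier ?H'" "\<psi> \<in> carrier ?H'"
    show "coboundary C d (n - 1) (\<phi> \<otimes>\<^bsub>?H'\<^esub> \<psi>) =
        coboundary C d (n - 1) \<phi> \<otimes>\<^bsub>?H\<^esub> coboundary C d (n - 1) \<psi>"
      unfolding cob using lmod_hom_closed[OF dh[of n]] by (auto simp: hom_group_def fun_eq_iff)
  qed
  then have "subgroup (coboundary C d (n - 1) ` carrier ?H') ?H"
    by (rule group_hom.img_is_subgroup)
  then have "trivial_group (cohomology R C d N n) \<longleftrightarrow>
      carrier ?H \<subseteq> coboundary C d (n - 1) ` carrier ?H'"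
    unfolding cohomology_def ker using trivial_quotient_iff[OF H] by simp
  also have "\<dots> \<longleftrightarrow> (\<forall>\<phi>\<in>lmod_hom R (C n) N. \<exists>\<psi>\<in>lmod_hom R (C (n - 1)) N.
      \<forall>x\<in>carrier (C n). \<phi> x = \<psi> (d n x))" (is "?L \<longleftrightarrow> ?R")
  proof
    assume L: ?L
    show ?R
    proof
      fix \<phi> assume "\<phi> \<in> lmod_hom R (C n) N"
      then have "restrict \<phi> (carrier (C n)) \<in> carrier ?H"
        by (auto simp: hom_group_def lmod_hom_def left_module.smult_closed[OF M]
            abelian_groupE[OF left_module.is_abelian_group[OF M]])
      then obtain \<psi> where \<psi>: "\<psi> \<in> carrier ?H'"
        and eq: "restrict \<phi> (carrier (C n)) = coboundary C d (n - 1) \<psi>" using L by blast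
      have "\<phi> x = \<psi> (d n x)" if "x \<in> carrier (C n)" for x
        using fun_cong[OF eq, of x] that by (simp add: cob)
      then show "\<exists>\<psi>\<in>lmod_hom R (C (n - 1)) N. \<forall>x\<in>carrier (C n). \<phi> x = \<psi> (d n x)"
        using \<psi> by (auto simp: hom_group_def)
    qed
  next
    assume R: ?R
    show ?L
    proof
      fix \<phi> assume \<phi>: "\<phi> \<in> carrier ?H"
      then obtain \<psi> where \<psi>: "\<psi> \<in> lmod_hom R (C (n - 1)) N"
        and eq: "\<forall>x\<in>carrier (C n). \<phi> x = \<psi> (d n x)" using R by (auto simp: hom_group_def)
      have "restrict \<psi> (carrier (C (n - 1))) \<in> carrier ?H'"
        using \<psi> by (auto simp: hom_group_def lmod_hom_def left_module.smult_closed[OF M]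
            abelian_groupE[OF left_module.is_abelian_group[OF M]])
      moreover have "\<phi> = coboundary C d (n - 1) (restrict \<psi> (carrier (C (n - 1))))"
        by (rule extensionalityI[of _ "carrier (C n)"])
          (use \<phi> eq lmod_hom_closed[OF dh[of n]] in \<open>auto simp: cob hom_group_def\<close>)
      ultimately show "\<phi> \<in> coboundary C d (n - 1) ` carrier ?H'" by blast
    qed
  qed
  finally show ?thesis .
qed

section \<open>Lowering the dimension of a complex\<close>

text \<open>
  In degree \<open>n\<close> the composite \<open>C \<rightarrow> D \<rightarrow> C\<close> vanishes, and so does the part of the homotopy that passes
  through \<open>C (n + 1)\<close>. What remains of the homotopy formula is \<open>- x = s (d x)\<close>.
\<close>

lemma retraction_of_top_boundary:
  assumes C: "chain_complex R C d" and D: "chain_complex R D e"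
    and C0: "zero_module (C (n + 1))" and D0: "zero_module (D n)"
    and che: "chain_homotopy_equivalent R C d D e"
  obtains \<rho> where "\<rho> \<in> lmod_hom R (C (n - 1)) (C n)"
    and "\<And>x. x \<in> carrier (C n) \<Longrightarrow> \<rho> (d n x) = x"
proof -
  have CM: "left_module R (C i)" and dh: "d i \<in> lmod_hom R (C i) (C (i - 1))" for i
    using C by (auto simp: chain_complex_def)
  have DM: "left_module R (D i)" for i using D by (auto simp: chain_complex_def)
  have Ca: "abelian_group (C i)" for i using CM by (rule left_module.is_abelian_group)
  have Da: "abelian_group (D i)" for i using DM by (rule left_module.is_abelian_group)
  obtain f g where f: "chain_map R C d D e f" and g: "chain_map R D e C d g"
    and gf: "chain_homotopic R C d C d (\<lambda>i. g i \<circ> f i) (\<lambda>i. id)"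
    using che unfolding chain_homotopy_equivalent_def by blast
  then have f: "f n \<in> lmod_hom R (C n) (D n)" and g: "g n \<in> lmod_hom R (D n) (C n)"
    by (auto simp: chain_map_def)
  obtain s where s: "\<And>i. s i \<in> lmod_hom R (C i) (C (i + 1))"
    and hom: "\<And>x. x \<in> carrier (C n) \<Longrightarrow>
      g n (f n x) \<ominus>\<^bsub>C n\<^esub> x = d (n + 1) (s n x) \<oplus>\<^bsub>C n\<^esub> s (n - 1) (d n x)"
    using gf unfolding chain_homotopic_def o_def id_def by blast
  interpret Cn: left_module R "C n" by (rule CM)
  have s': "s (n - 1) \<in> lmod_hom R (C (n - 1)) (C n)" using s[of "n - 1"] by simp
  have d': "d (n + 1) \<in> lmod_hom R (C (n + 1)) (C n)" using dh[of "n + 1"] by simp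
  have "\<ominus>\<^bsub>C n\<^esub> s (n - 1) (d n x) = x" if x: "x \<in> carrier (C n)" for x
  proof -
    have "g n (f n x) = \<zero>\<^bsub>C n\<^esub>"
      using lmod_hom_closed[OF f x] D0 lmod_hom_zero[OF Da Ca g] by (simp add: zero_module_def)
    moreover have "d (n + 1) (s n x) = \<zero>\<^bsub>C n\<^esub>"
      using lmod_hom_closed[OF s x] C0 lmod_hom_zero[OF Ca Ca d'] by (simp add: zero_module_def)
    moreover have c: "s (n - 1) (d n x) \<in> carrier (C n)"
      using lmod_hom_closed[OF s' lmod_hom_closed[OF dh x]] .
    ultimately have "\<ominus>\<^bsub>C n\<^esub> x = s (n - 1) (d n x)"
      using hom[OF x] x by (simp add: Cn.M.minus_eq)
    then show ?thesis using x by (metis Cn.M.minus_minus)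
  qed
  then show thesis
    by (rule that[OF Cn.minus_lmod_hom[OF s']])
qed

text \<open>
  \<open>D\<close> is the image of the idempotent chain map \<open>p\<close> that is the identity below degree \<open>n - 1\<close>, \<open>1 - d \<rho>\<close>
  in degree \<open>n - 1\<close> and \<open>0\<close> above. It is homotopic to the identity through \<open>- \<rho>\<close>. As a retract of
  \<open>C i\<close>, each \<open>D i\<close> is projective.
\<close>

lemma lower_dimension:
  fixes C :: "int \<Rightarrow> ('r, 'm) module"
  assumes C: "chain_complex R C d" and proj: "\<And>i. projective_module R (C i)"
    and C0: "\<And>i. i > n \<Longrightarrow> zero_module (C i)"
    and \<rho>: "\<rho> \<in> lmod_hom R (C (n - 1)) (C n)"
    and \<rho>d: "\<And>x. x \<in> carrier (C n) \<Longrightarrow> \<rho> (d n x) = x"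
  obtains D :: "int \<Rightarrow> ('r, 'm) module" where "chain_complex R D d"
    and "\<And>i. projective_module R (D i)" and "\<And>i. i > n - 1 \<Longrightarrow> zero_module (D i)"
    and "chain_homotopy_equivalent R C d D d"
proof -
  have CM: "left_module R (C i)" and dh: "d i \<in> lmod_hom R (C i) (C (i - 1))" for i
    using C by (auto simp: chain_complex_def)
  have dd: "d (i - 1) (d i x) = \<zero>\<^bsub>C (i - 1 - 1)\<^esub>" if "x \<in> carrier (C i)" for i x
    using C that by (auto simp: chain_complex_def)
  have ab: "abelian_group (C i)" for i using CM by (rule left_module.is_abelian_group)
  interpret M: left_module R "C i" for i by (rule CM)
  define p where "p i = (if i < n - 1 then id else if i = n - 1 then (\<lambda>x. x \<oplus>\<^bsub>C i\<^esub> (\<ominus>\<^bsub>C i\<^esub> d n (\<rho> x)))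
    else (\<lambda>x. \<zero>\<^bsub>C i\<^esub>))" for i
  have dn: "d n \<circ> \<rho> \<in> lmod_hom R (C (n - 1)) (C (n - 1))" by (rule lmod_hom_comp[OF \<rho> dh])
  have ph: "p i \<in> lmod_hom R (C i) (C i)" for i
    unfolding p_def
    using M.add_lmod_hom[OF lmod_hom_id M.minus_lmod_hom[OF dn]] M.zero_lmod_hom lmod_hom_id by auto
  have pd: "p (i - 1) (d i x) = d i (p i x)" if x: "x \<in> carrier (C i)" for i x
  proof -
    consider "i < n - 1" | "i = n - 1" | "i = n" | "i > n" by linarith
    then show ?thesis
    proof cases
      case 2
      then have c: "d n (\<rho> x) \<in> carrier (C i)" "\<rho> x \<in> carrier (C n)"
        using x lmod_hom_closed[OF dn] lmod_hom_closed[OF \<rho>] by auto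
      have "d i (d n (\<rho> x)) = \<zero>\<^bsub>C (i - 1)\<^esub>" using dd[OF c(2)] 2 by simp
      then have "d i (p i x) = d i x"
        using 2 x c lmod_hom_closed[OF dh x]
        by (simp add: p_def lmod_hom_add[OF dh] lmod_hom_minus[OF ab ab dh])
      then show ?thesis using 2 by (simp add: p_def)
    next
      case 3
      then show ?thesis
        using \<rho>d x lmod_hom_closed[OF dh x] lmod_hom_zero[OF ab ab dh]
        by (auto simp: p_def M.r_neg)
    qed (auto simp: p_def lmod_hom_zero[OF ab ab dh])
  qed
  have pp: "p i (p i x) = p i x" if x: "x \<in> carrier (C i)" for i x
  proof (cases "i = n - 1")
    case True
    then have c: "\<rho> x \<in> carrier (C n)" "d n (\<rho> x) \<in> carrier (C (n - 1))"
      using x lmod_hom_closed[OF dn] lmod_hom_closed[OF \<rho>] by auto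
    then have "p (n - 1) (d n (\<rho> x)) = \<zero>\<^bsub>C (n - 1)\<^esub>"
      by (simp add: p_def \<rho>d M.r_neg)
    moreover have "p i (p i x) = p i (x \<oplus>\<^bsub>C i\<^esub> (\<ominus>\<^bsub>C i\<^esub> d n (\<rho> x)))"
      using True by (simp add: p_def)
    ultimately show ?thesis
      using True x c lmod_hom_closed[OF ph x]
      by (simp add: lmod_hom_add[OF ph] lmod_hom_minus[OF ab ab ph])
  qed (auto simp: p_def)
  define D where "D i = (C i)\<lparr>carrier := {x \<in> carrier (C i). p i x = x}\<rparr>" for i
  have DM: "left_module R (D i)" for i
    unfolding D_def
    by (rule M.submodule_left_module)
      (auto simp: lmod_homD[OF ph] lmod_hom_zero[OF ab ab ph] lmod_hom_minus[OF ab ab ph])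
  interpret DM: left_module R "D i" for i by (rule DM)
  have incl: "id \<in> lmod_hom R (D i) (C i)" for i by (rule lmod_homI) (auto simp: D_def)
  have pD: "p i \<in> lmod_hom R (C i) (D i)" for i
    by (rule lmod_homI) (auto simp: D_def pp lmod_homD[OF ph])
  have pfix: "p i x = x" "x \<in> carrier (C i)" if "x \<in> carrier (D i)" for i x
    using that by (auto simp: D_def)
  have dD: "d i \<in> lmod_hom R (D i) (D (i - 1))" for i
    by (rule lmod_homI) (auto simp: D_def pd lmod_homD[OF dh])
  show thesis
  proof
    show "chain_complex R D d"
      unfolding chain_complex_def
    proof (intro conjI allI ballI DM dD)
      fix i x assume "x \<in> carrier (D i)"
      then show "d (i - 1) (d i x) = \<zero>\<^bsub>D (i - 1 - 1)\<^esub>"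
        using dd[OF pfix(2)] by (simp add: D_def)
    qed
    show "projective_module R (D i)" for i
    proof -
      obtain X :: "'m set" and b c where "dual_basis R (C i) X b c"
        using proj by (rule projective_imp_dual_basis)
      then have "dual_basis R (D i) X (p i \<circ> b) (c \<circ> id)"
        by (rule dual_basis_retract[OF CM DM _ incl pD]) (simp add: pfix(1))
      then show ?thesis by (rule dual_basis_imp_projective[OF DM])
    qed
    show "zero_module (D i)" if "i > n - 1" for i
      using that M.zero_closed unfolding zero_module_def D_def p_def by auto
    define s where "s i = (if i = n - 1 then (\<lambda>x. \<ominus>\<^bsub>C n\<^esub> \<rho> x) else (\<lambda>x. \<zero>\<^bsub>C (i + 1)\<^esub>))" for i
    have "chain_homotopic R C d C d (\<lambda>i. id \<circ> p i) (\<lambda>i. id)"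
      unfolding chain_homotopic_def
    proof (intro exI[of _ s] conjI allI ballI)
      show "s i \<in> lmod_hom R (C i) (C (i + 1))" for i
        unfolding s_def using M.minus_lmod_hom[OF \<rho>] M.zero_lmod_hom by auto
      fix i x assume x: "x \<in> carrier (C i)"
      have dz: "d (i + 1) \<zero>\<^bsub>C (i + 1)\<^esub> = \<zero>\<^bsub>C i\<^esub>"
        using lmod_hom_zero[OF ab ab dh, of "i + 1"] by simp
      consider "i < n - 1" | "i = n - 1" | "i = n" | "i > n" by linarith
      then show "(id \<circ> p i) x \<ominus>\<^bsub>C i\<^esub> id x = d (i + 1) (s i x) \<oplus>\<^bsub>C i\<^esub> s (i - 1) (d i x)"
      proof cases
        case 1
        then show ?thesis using x dz by (simp add: p_def s_def M.minus_eq M.r_neg)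
      next
        case 2
        then have c: "\<rho> x \<in> carrier (C n)" "d n (\<rho> x) \<in> carrier (C (n - 1))"
          using x lmod_hom_closed[OF dn] lmod_hom_closed[OF \<rho>] by auto
        have "(x \<oplus>\<^bsub>C i\<^esub> \<ominus>\<^bsub>C i\<^esub> d n (\<rho> x)) \<oplus>\<^bsub>C i\<^esub> \<ominus>\<^bsub>C i\<^esub> x = \<ominus>\<^bsub>C i\<^esub> d n (\<rho> x)"
          using x c 2 by (metis M.a_ac(1) M.a_comm M.a_inv_closed M.r_neg M.r_zero)
        then show ?thesis
          using 2 c x by (simp add: p_def s_def M.minus_eq lmod_hom_minus[OF ab ab dh])
      next
        case 3
        then show ?thesis using x dz by (simp add: p_def s_def M.minus_eq \<rho>d)
      next
        case 4
        then have "x = \<zero>\<^bsub>C i\<^esub>" using x C0 by (auto simp: zero_module_def)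
        then show ?thesis using 4 dz by (simp add: p_def s_def M.minus_eq)
      qed
    qed
    moreover have "chain_homotopic R D d D d (\<lambda>i. p i \<circ> id) (\<lambda>i. id)"
      unfolding chain_homotopic_def
    proof (intro exI[of _ "\<lambda>i x. \<zero>\<^bsub>D (i + 1)\<^esub>"] conjI allI ballI)
      fix i x assume x: "x \<in> carrier (D i)"
      have "d (i + 1) \<zero>\<^bsub>D (i + 1)\<^esub> = \<zero>\<^bsub>D i\<^esub>"
        using lmod_hom_zero[OF DM.is_abelian_group DM.is_abelian_group dD, of "i + 1"] by simp
      then show "(p i \<circ> id) x \<ominus>\<^bsub>D i\<^esub> id x = d (i + 1) \<zero>\<^bsub>D (i + 1)\<^esub> \<oplus>\<^bsub>D i\<^esub> \<zero>\<^bsub>D (i - 1 + 1)\<^esub>"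
        using pfix(1)[OF x] x by (simp add: DM.minus_eq DM.r_neg)
    qed (rule DM.zero_lmod_hom)
    moreover have "chain_map R C d D d p" "chain_map R D d C d (\<lambda>i. id)"
      using pD incl pd by (auto simp: chain_map_def)
    ultimately show "chain_homotopy_equivalent R C d D d"
      unfolding chain_homotopy_equivalent_def by blast
  qed
qed

section \<open>Grading by a character\<close>

lemma (in left_module) restrict_scalars:
  assumes S: "ring S" and sub: "carrier S \<subseteq> carrier R"
    and add: "\<And>a b. a \<in> carrier S \<Longrightarrow> b \<in> carrier S \<Longrightarrow> a \<oplus>\<^bsub>S\<^esub> b = a \<oplus> b"
    and mult: "\<And>a b. a \<in> carrier S \<Longrightarrow> b \<in> carrier S \<Longrightarrow> a \<otimes>\<^bsub>S\<^esub> b = a \<otimes> b"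
    and one: "\<one>\<^bsub>S\<^esub> = \<one>"
  shows "left_module S M"
  using sub by (intro left_module.intro left_module_axioms.intro S is_abelian_group)
    (auto simp: add mult one smult_l_distr smult_r_distr smult_assoc subset_eq)

definition level_part :: "('g \<Rightarrow> real) \<Rightarrow> real set \<Rightarrow> ('g \<Rightarrow> int) \<Rightarrow> 'g \<Rightarrow> int" where
  "level_part \<chi> A w = (\<lambda>g. if \<chi> g \<in> A then w g else 0)"

text \<open>
  The level of \<open>g\<close> is \<open>\<chi> g\<close>. Integrality of \<open>\<chi>\<close> enters through the fact that a bounded interval contains
  finitely many levels.
\<close>

locale graded_group = group G for G :: "('g, 'b) monoid_scheme" (structure) +
  fixes \<chi> :: "'g \<Rightarrow> real"
  assumes chi_mult: "\<And>g h. g \<in> carrier G \<Longrightarrow> h \<in> carrier G \<Longrightarrow> \<chi> (g \<otimes> h) = \<chi> g + \<chi> h"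
    and chi_Ints: "\<And>g. g \<in> carrier G \<Longrightarrow> \<chi> g \<in> \<int>"
begin

abbreviation K where "K \<equiv> character_kernel G \<chi>"

lemma chi_one [simp]: "\<chi> \<one> = 0"
  using chi_mult[of \<one> \<one>] by simp

lemma chi_inv: "g \<in> carrier G \<Longrightarrow> \<chi> (inv g) = - \<chi> g"
  using chi_mult[of "inv g" g] by simp

lemma mem_kernel: "g \<in> carrier K \<longleftrightarrow> g \<in> carrier G \<and> \<chi> g = 0"
  by (simp add: character_kernel_def kernel_def real_group_def)

lemma kernel_group: "group K"
proof -
  have "subgroup (kernel G real_group \<chi>) G"
    by (rule subgroupI) (auto simp: kernel_def real_group_def chi_mult chi_inv intro: exI[of _ \<one>])
  then show ?thesis unfolding character_kernel_def by (rule subgroup.subgroup_is_group[OF _ is_group])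
qed

lemma kernel_ring: "ring (group_ring K)"
  using kernel_group by (rule group.group_ring_ring)

lemma kernel_ring_carrier:
  "r \<in> carrier (group_ring K) \<longleftrightarrow> r \<in> carrier (group_ring G) \<and> (\<forall>g. r g \<noteq> 0 \<longrightarrow> \<chi> g = 0)"
  by (auto simp: group_ring_carrier mem_kernel)

lemma kernel_ring_subset: "carrier (group_ring K) \<subseteq> carrier (group_ring G)"
  by (auto simp: kernel_ring_carrier)

lemma series_mult_kernel:
  assumes "r \<in> carrier (group_ring K)" "s \<in> carrier (group_ring K)"
  shows "series_mult K r s = series_mult G r s"
proof
  fix g
  have "{(h, k). h \<in> carrier K \<and> k \<in> carrier K \<and> h \<otimes>\<^bsub>K\<^esub> k = g \<and> r h \<noteq> 0 \<and> s k \<noteq> 0} =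
      {(h, k). h \<in> carrier G \<and> k \<in> carrier G \<and> h \<otimes> k = g \<and> r h \<noteq> 0 \<and> s k \<noteq> 0}"
    using assms by (auto simp: group_ring_carrier mem_kernel) (auto simp: character_kernel_def)
  then show "series_mult K r s g = series_mult G r s g" unfolding series_mult_def by simp
qed

lemma kernel_left_module:
  assumes "left_module (group_ring G) M"
  shows "left_module (group_ring K) M"
proof -
  interpret left_module "group_ring G" M by fact
  show ?thesis
    by (rule restrict_scalars[OF kernel_ring kernel_ring_subset])
      (auto simp: series_mult_kernel, simp add: character_kernel_def)
qed

lemma novikov_left_module: "left_module (group_ring G) (novikov_module G \<chi>)"
proof -
  have closed: "series_mult G r w \<in> carrier (novikov_module G \<chi>)"
    if r: "r \<in> carrier (group_ring G)" and w: "w \<in> carrier (novikov_module G \<chi>)" for r w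
  proof -
    have "finite {g. series_mult G r w g \<noteq> 0 \<and> \<chi> g \<le> t}" for t
    proof (rule finite_subset)
      show "{g. series_mult G r w g \<noteq> 0 \<and> \<chi> g \<le> t} \<subseteq>
          (\<Union>h\<in>{h. r h \<noteq> 0}. (\<lambda>k. h \<otimes> k) ` {k. w k \<noteq> 0 \<and> \<chi> k \<le> t - \<chi> h})"
      proof
        fix g assume "g \<in> {g. series_mult G r w g \<noteq> 0 \<and> \<chi> g \<le> t}"
        then show "g \<in> (\<Union>h\<in>{h. r h \<noteq> 0}. (\<lambda>k. h \<otimes> k) ` {k. w k \<noteq> 0 \<and> \<chi> k \<le> t - \<chi> h})"
          by (auto elim!: series_mult_nonzeroE simp: chi_mult)
      qed
      show "finite (\<Union>h\<in>{h. r h \<noteq> 0}. (\<lambda>k. h \<otimes> k) ` {k. w k \<noteq> 0 \<and> \<chi> k \<le> t - \<chi> h})"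
        using r w by (auto simp: group_ring_carrier novikov_module_carrier)
    qed
    then show ?thesis by (auto simp: novikov_module_carrier elim!: series_mult_nonzeroE)
  qed
  have "series_mult G (delta \<one>) w = w" if "w \<in> carrier (novikov_module G \<chi>)" for w
    using that by (auto simp: series_mult_delta fun_eq_iff novikov_module_carrier)
  then show ?thesis
    using closed by (intro left_module.intro left_module_axioms.intro group_ring_ring novikov_abelian_group)
      (auto simp: series_mult_add_left series_mult_add_right series_mult_assoc)
qed

text \<open>
  Multiplication by an element of \<open>K\<close> preserves levels. This is the source of all maps below that are
  linear over the group ring of \<open>K\<close> but not over that of \<open>G\<close>.
\<close>

lemma level_part_series_mult:
  assumes "r \<in> carrier (group_ring K)"
  shows "level_part \<chi> A (series_mult G r w) = series_mult G r (level_part \<chi> A w)"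
proof
  fix g
  have r: "r \<in> carrier (group_ring G)" "\<And>h. r h \<noteq> 0 \<Longrightarrow> h \<in> carrier G \<and> \<chi> h = 0"
    using assms by (auto simp: group_ring_carrier mem_kernel)
  have "(\<Sum>h | r h \<noteq> 0. r h * level_part \<chi> A w (inv h \<otimes> g)) =
      (\<Sum>h | r h \<noteq> 0. r h * (if \<chi> g \<in> A then w (inv h \<otimes> g) else 0))" if "g \<in> carrier G"
    by (rule sum.cong) (use r(2) that in \<open>auto simp: level_part_def chi_mult chi_inv\<close>)
  then show "level_part \<chi> A (series_mult G r w) g = series_mult G r (level_part \<chi> A w) g"
    by (auto simp: series_mult_group_ring[OF r(1)]) (auto simp: level_part_def series_mult_group_ring[OF r(1)])
qed

text \<open>
  The group ring of \<open>G\<close> is free over that of \<open>K\<close>, with one basis element from each coset. The cosets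
  of \<open>K\<close> correspond to the levels, which therefore serve as indices.
\<close>

lemma free_module_kernel_dual_basis:
  fixes X :: "'x set"
  obtains Y :: "('x \<times> real) set" and b c
  where "dual_basis (group_ring K) (free_module (group_ring G) X) Y b c"
proof -
  interpret G: ring "group_ring G" by (rule group_ring_ring)
  let ?F = "free_module (group_ring G) X"
  interpret F: left_module "group_ring G" ?F by (rule G.free_left_module)
  interpret FK: left_module "group_ring K" ?F by (rule kernel_left_module[OF F.left_module_axioms])
  define rep where "rep j = (SOME g. g \<in> carrier G \<and> \<chi> g = j)" for j
  define J where "J = \<chi> ` carrier G"
  have rep: "rep j \<in> carrier G" "\<chi> (rep j) = j" if "j \<in> J" for j
    using someI_ex[of "\<lambda>g. g \<in> carrier G \<and> \<chi> g = j"] that by (auto simp: J_def rep_def)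
  define b :: "'x \<times> real \<Rightarrow> 'x \<Rightarrow> 'g \<Rightarrow> int"
    where "b = (\<lambda>(y, j) z. if z = y then delta (rep j) else (\<lambda>g. 0))"
  define c :: "('x \<Rightarrow> 'g \<Rightarrow> int) \<Rightarrow> 'x \<times> real \<Rightarrow> 'g \<Rightarrow> int"
    where "c = (\<lambda>f (y, j) k. if k \<in> carrier K \<and> j \<in> J then f y (k \<otimes> rep j) else 0)"
  let ?Y = "X \<times> J"
  have b: "b \<in> ?Y \<rightarrow> carrier ?F"
    using rep by (auto simp: b_def free_module_carrier delta_closed group_ring_zero_closed)
  have coeff: "f y \<in> carrier (group_ring G)" if "f \<in> carrier ?F" for f y
    using that by (rule G.free_module_coeff)
  have ck: "c f p \<in> carrier (group_ring K)" if f: "f \<in> carrier ?F" for f p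
  proof -
    obtain y j where p: "p = (y, j)" by force
    have "{k. c f p k \<noteq> 0} \<subseteq> (\<lambda>g. g \<otimes> inv (rep j)) ` {g. f y g \<noteq> 0}"
    proof
      fix k assume "k \<in> {k. c f p k \<noteq> 0}"
      then have "k \<in> carrier G" "j \<in> J" "f y (k \<otimes> rep j) \<noteq> 0"
        by (auto simp: p c_def mem_kernel split: if_splits)
      then show "k \<in> (\<lambda>g. g \<otimes> inv (rep j)) ` {g. f y g \<noteq> 0}"
        using rep by (intro image_eqI[of _ _ "k \<otimes> rep j"]) (auto simp: m_assoc)
    qed
    then have "finite {k. c f p k \<noteq> 0}"
      using coeff[OF f, of y] by (auto simp: group_ring_carrier intro: finite_subset)
    then show ?thesis by (auto simp: group_ring_carrier p c_def split: if_splits)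
  qed
  have cF: "c f \<in> carrier (free_module (group_ring K) ?Y)" if f: "f \<in> carrier ?F" for f
  proof -
    have "{p. c f p \<noteq> (\<lambda>g. 0)} \<subseteq>
        (\<lambda>(y, g). (y, \<chi> g)) ` (SIGMA y:{y. f y \<noteq> (\<lambda>g. 0)}. {g. f y g \<noteq> 0})"
    proof
      fix p assume p: "p \<in> {p. c f p \<noteq> (\<lambda>g. 0)}"
      obtain y j where yj: "p = (y, j)" by force
      then obtain k where "c f (y, j) k \<noteq> 0" using p by (auto simp: fun_eq_iff)
      then have k: "k \<in> carrier K" "j \<in> J" "f y (k \<otimes> rep j) \<noteq> 0"
        by (auto simp: c_def split: if_splits)
      then have "\<chi> (k \<otimes> rep j) = j" using rep by (simp add: mem_kernel chi_mult)
      then show "p \<in> (\<lambda>(y, g). (y, \<chi> g)) ` (SIGMA y:{y. f y \<noteq> (\<lambda>g. 0)}. {g. f y g \<noteq> 0})"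
        using k by (intro image_eqI[of _ _ "(y, k \<otimes> rep j)"]) (auto simp: yj)
    qed
    moreover have "finite (SIGMA y:{y. f y \<noteq> (\<lambda>g. 0)}. {g. f y g \<noteq> 0})"
      using f coeff[OF f] by (intro finite_SigmaI) (auto simp: free_module_carrier group_ring_carrier)
    ultimately have "finite {p. c f p \<noteq> (\<lambda>g. 0)}" by (blast intro: finite_surj)
    moreover have "c f p = (\<lambda>g. 0)" if "p \<notin> ?Y" for p
      using that f by (cases p) (auto simp: c_def free_module_carrier)
    ultimately show ?thesis using ck[OF f] by (auto simp: free_module_carrier)
  qed
  have c: "c \<in> lmod_hom (group_ring K) ?F (free_module (group_ring K) ?Y)"
  proof (rule lmod_homI)
    fix r f assume r: "r \<in> carrier (group_ring K)" and f: "f \<in> carrier ?F"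
    have rG: "r \<in> carrier (group_ring G)" "\<And>h. r h \<noteq> 0 \<Longrightarrow> h \<in> carrier G \<and> \<chi> h = 0"
      using r by (auto simp: group_ring_carrier mem_kernel)
    have "c (r \<odot>\<^bsub>?F\<^esub> f) (y, j) k = series_mult K r (c f (y, j)) k" for y j k
    proof (cases "k \<in> carrier K \<and> j \<in> J")
      case True
      then have k: "k \<in> carrier G" "\<chi> k = 0" "rep j \<in> carrier G"
        using rep by (auto simp: mem_kernel)
      have "c (r \<odot>\<^bsub>?F\<^esub> f) (y, j) k = (\<Sum>h | r h \<noteq> 0. r h * f y (inv h \<otimes> (k \<otimes> rep j)))"
        using True k rG by (simp add: c_def free_module_simps series_mult_group_ring)
      also have "\<dots> = (\<Sum>h | r h \<noteq> 0. r h * c f (y, j) (inv h \<otimes> k))"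
        by (rule sum.cong) (use rG(2) k True in \<open>auto simp: c_def mem_kernel chi_mult chi_inv m_assoc\<close>)
      also have "\<dots> = series_mult K r (c f (y, j)) k"
        using k by (simp add: series_mult_kernel[OF r ck[OF f]] series_mult_group_ring[OF rG(1)])
      finally show ?thesis .
    next
      case False
      have "series_mult K r (c f (y, j)) k = 0"
      proof (rule ccontr)
        assume "series_mult K r (c f (y, j)) k \<noteq> 0"
        then obtain h k' where "h \<in> carrier K" "k' \<in> carrier K" "h \<otimes>\<^bsub>K\<^esub> k' = k" "c f (y, j) k' \<noteq> 0"
          by (rule series_mult_nonzeroE)
        then show False
          using False group.is_monoid[OF kernel_group, THEN monoid.m_closed, of h k']
          by (auto simp: c_def split: if_splits)
      qed
      then show ?thesis using False by (auto simp: c_def)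
    qed
    then show "c (r \<odot>\<^bsub>?F\<^esub> f) = r \<odot>\<^bsub>free_module (group_ring K) ?Y\<^esub> c f"
      by (auto simp: free_module_simps fun_eq_iff)
  qed (use cF in \<open>auto simp: c_def free_module_simps fun_eq_iff\<close>)
  have "lincomb (group_ring K) ?F b (c f) = f" if f: "f \<in> carrier ?F" for f
  proof (intro ext)
    fix z g
    let ?A = "{p. c f p \<noteq> (\<lambda>g. 0)}"
    have A: "finite ?A" "?A \<subseteq> ?Y" using cF[OF f] by (auto simp: free_module_carrier)
    have cl: "c f p \<odot>\<^bsub>?F\<^esub> b p \<in> carrier ?F" if "p \<in> ?A" for p
    proof -
      have "b p \<in> carrier ?F" using that A b by blast
      then show ?thesis using ck[OF f] by simp
    qed
    \<comment> \<open>Of the whole linear combination only the basis element in position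
      \<open>z\<close> and of the level of \<open>g\<close> contributes to the coefficient at
      \<open>z\<close> and \<open>g\<close>.\<close>
    have val: "(c f p \<odot>\<^bsub>?F\<^esub> b p) z g = (if p = (z, \<chi> g) then f z g else 0)" if p: "p \<in> ?A" for p
    proof (cases "g \<in> carrier G")
      case g: True
      obtain y j where yj: "p = (y, j)" by force
      then have j: "j \<in> J" using p A by auto
      have cG: "c f p \<in> carrier (group_ring G)" using ck[OF f] kernel_ring_subset by blast
      show ?thesis
      proof (cases "z = y")
        case True
        then have "(c f p \<odot>\<^bsub>?F\<^esub> b p) z g = c f (y, j) (g \<otimes> inv (rep j))"
          using series_mult_delta_right[OF cG rep(1)[OF j] g] by (simp add: yj b_def free_module_simps)
        also have "\<dots> = (if p = (z, \<chi> g) then f z g else 0)"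
          using rep[OF j] g j True by (auto simp: c_def mem_kernel chi_mult chi_inv yj m_assoc)
        finally show ?thesis .
      next
        case False
        then show ?thesis using g cG by (simp add: yj b_def free_module_simps series_mult_group_ring)
      qed
    next
      case False
      then have "f z g = 0" using coeff[OF f, of z] by (auto simp: group_ring_carrier)
      then show ?thesis using False by (simp add: free_module_simps series_mult_outside)
    qed
    have "lincomb (group_ring K) ?F b (c f) z g = (\<Sum>p\<in>?A. (c f p \<odot>\<^bsub>?F\<^esub> b p) z g)"
      using cl A coeff[OF cl] by (simp add: lincomb_def G.free_finsum_apply group_ring_finsum_apply Pi_def)
    also have "\<dots> = (\<Sum>p\<in>?A. if p = (z, \<chi> g) then f z g else 0)"
      by (rule sum.cong) (use val in auto)
    also have "\<dots> = (if (z, \<chi> g) \<in> ?A then f z g else 0)"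
      using A by simp
    also have "\<dots> = f z g"
    proof -
      have "f z g = 0" if "c f (z, \<chi> g) = (\<lambda>g. 0)"
      proof (cases "g \<in> carrier G")
        case g: True
        then have j: "\<chi> g \<in> J" by (simp add: J_def)
        have "c f (z, \<chi> g) (g \<otimes> inv (rep (\<chi> g))) = f z g"
          using rep[OF j] g j by (auto simp: c_def mem_kernel chi_mult chi_inv m_assoc)
        then show ?thesis using that by simp
      next
        case False
        then show ?thesis using coeff[OF f, of z] by (auto simp: group_ring_carrier)
      qed
      then show ?thesis by auto
    qed
    finally show "lincomb (group_ring K) ?F b (c f) z g = f z g" .
  qed
  then have "dual_basis (group_ring K) ?F ?Y b c" using b c by (simp add: dual_basis_def)
  then show thesis by (rule that)
qed

lemma projective_over_kernel:
  fixes P :: "('g \<Rightarrow> int, 'm) module"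
  assumes "projective_module (group_ring G) P"
  shows "projective_module (group_ring K) P"
proof -
  have P: "left_module (group_ring G) P" using assms by (simp add: projective_module_def)
  interpret P: left_module "group_ring G" P by fact
  obtain X :: "'m set" and b c where db: "dual_basis (group_ring G) P X b c"
    using assms by (rule projective_imp_dual_basis)
  let ?F = "free_module (group_ring G) X"
  have F: "left_module (group_ring G) ?F" by (rule P.R.free_left_module)
  obtain Y :: "('m \<times> real) set" and b' c' where db': "dual_basis (group_ring K) ?F Y b' c'"
    by (rule free_module_kernel_dual_basis)
  have "c \<in> lmod_hom (group_ring K) P ?F" "lincomb (group_ring G) P b \<in> lmod_hom (group_ring K) ?F P"
    using db P.lincomb_lmod_hom[of b X] lmod_hom_restrict_scalars[OF kernel_ring_subset]
    by (auto simp: dual_basis_def)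
  then have "dual_basis (group_ring K) P Y (lincomb (group_ring G) P b \<circ> b') (c' \<circ> c)"
    by (rule dual_basis_retract[OF kernel_left_module[OF F] kernel_left_module[OF P] db'])
      (use db in \<open>auto simp: dual_basis_def\<close>)
  then show ?thesis by (rule dual_basis_imp_projective[OF kernel_left_module[OF P]])
qed

text \<open>
  Each coordinate of \<open>P\<close> factors through \<open>d\<close> with values in either Novikov module. Gluing the lower part
  of the one factorisation to the upper part of the other gives finite series.
\<close>

lemma retraction_from_factorisations:
  fixes P :: "('g \<Rightarrow> int, 'm) module" and Q :: "('g \<Rightarrow> int, 'n) module"
  assumes proj: "projective_module (group_ring G) P"
    and fg: "finitely_generated_module (group_ring G) P"
    and Q: "left_module (group_ring G) Q" and d: "d \<in> lmod_hom (group_ring G) P Q"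
    and pos: "\<And>\<phi>. \<phi> \<in> lmod_hom (group_ring G) P (novikov_module G \<chi>) \<Longrightarrow>
      \<exists>\<psi>\<in>lmod_hom (group_ring G) Q (novikov_module G \<chi>). \<forall>x\<in>carrier P. \<phi> x = \<psi> (d x)"
    and neg: "\<And>\<phi>. \<phi> \<in> lmod_hom (group_ring G) P (novikov_module G (\<lambda>g. - \<chi> g)) \<Longrightarrow>
      \<exists>\<psi>\<in>lmod_hom (group_ring G) Q (novikov_module G (\<lambda>g. - \<chi> g)). \<forall>x\<in>carrier P. \<phi> x = \<psi> (d x)"
  obtains \<rho> where "\<rho> \<in> lmod_hom (group_ring K) Q P" and "\<And>x. x \<in> carrier P \<Longrightarrow> \<rho> (d x) = x"
proof -
  have P: "left_module (group_ring G) P" using proj by (simp add: projective_module_def)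
  interpret P: left_module "group_ring G" P by fact
  obtain X :: "'m set" and b c where db0: "dual_basis (group_ring G) P X b c"
    using proj by (rule projective_imp_dual_basis)
  obtain Y where Y: "finite Y" and db: "dual_basis (group_ring G) P Y b c"
    using finite_dual_basis[OF P fg db0] .
  let ?F = "free_module (group_ring G) Y"
  have b: "b \<in> Y \<rightarrow> carrier P" and c: "c \<in> lmod_hom (group_ring G) P ?F"
    and bc: "\<And>x. x \<in> carrier P \<Longrightarrow> lincomb (group_ring G) P b (c x) = x"
    using db by (auto simp: dual_basis_def)
  have coord: "(\<lambda>x. c x y) \<in> lmod_hom (group_ring G) P (novikov_module G \<xi>)" for y \<xi>
  proof (rule lmod_homI)
    fix x assume x: "x \<in> carrier P"
    then show "c x y \<in> carrier (novikov_module G \<xi>)"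
      using P.R.free_module_coeff[OF lmod_hom_closed[OF c x], of y] group_ring_subset_novikov by blast
  qed (auto simp: lmod_hom_add[OF c] lmod_hom_smult[OF c] free_module_simps)
  obtain u where u: "\<And>y. u y \<in> lmod_hom (group_ring G) Q (novikov_module G \<chi>)"
    and ud: "\<And>x y. x \<in> carrier P \<Longrightarrow> u y (d x) = c x y"
    using pos[OF coord] by metis
  obtain v where v: "\<And>y. v y \<in> lmod_hom (group_ring G) Q (novikov_module G (\<lambda>g. - \<chi> g))"
    and vd: "\<And>x y. x \<in> carrier P \<Longrightarrow> v y (d x) = c x y"
    using neg[OF coord] by metis
  \<comment> \<open>\<open>u y q\<close> has finitely many terms in levels \<open>\<le> 0\<close> and
    \<open>v y q\<close> has finitely many in levels \<open>> 0\<close>.\<close>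
  define \<eta> where "\<eta> q y = (if y \<in> Y then (\<lambda>g. level_part \<chi> {..0} (u y q) g + level_part \<chi> {0<..} (v y q) g)
    else (\<lambda>g. 0))" for q y
  have "\<eta> q \<in> carrier ?F" if q: "q \<in> carrier Q" for q
  proof -
    have "level_part \<chi> {..0} (u y q) \<in> carrier (group_ring G)" for y
    proof -
      have w: "u y q \<in> carrier (novikov_module G \<chi>)" by (rule lmod_hom_closed[OF u q])
      then have "finite {g. u y q g \<noteq> 0 \<and> \<chi> g \<le> 0}" by (auto simp: novikov_module_carrier)
      then have "finite {g. level_part \<chi> {..0} (u y q) g \<noteq> 0}"
        by (rule rev_finite_subset) (auto simp: level_part_def)
      then show ?thesis using w
        by (auto simp: novikov_module_carrier group_ring_carrier level_part_def split: if_splits)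
    qed
    moreover have "level_part \<chi> {0<..} (v y q) \<in> carrier (group_ring G)" for y
    proof -
      have w: "v y q \<in> carrier (novikov_module G (\<lambda>g. - \<chi> g))" by (rule lmod_hom_closed[OF v q])
      then have "finite {g. v y q g \<noteq> 0 \<and> - \<chi> g \<le> 0}"
        unfolding novikov_module_carrier by blast
      then have "finite {g. level_part \<chi> {0<..} (v y q) g \<noteq> 0}"
        by (rule rev_finite_subset) (auto simp: level_part_def)
      then show ?thesis using w
        by (auto simp: novikov_module_carrier group_ring_carrier level_part_def split: if_splits)
    qed
    moreover have "finite {y. \<eta> q y \<noteq> (\<lambda>g. 0)}"
      by (rule finite_subset[OF _ Y]) (auto simp: \<eta>_def)
    ultimately show ?thesis
      by (auto simp: free_module_carrier \<eta>_def intro!: group_ring_add_closed)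
  qed
  moreover have "\<eta> (r \<odot>\<^bsub>Q\<^esub> q) = r \<odot>\<^bsub>?F\<^esub> \<eta> q"
    if r: "r \<in> carrier (group_ring K)" and q: "q \<in> carrier Q" for r q
  proof -
    have rG: "r \<in> carrier (group_ring G)" using r kernel_ring_subset by blast
    have "series_mult G r (\<lambda>g. 0) = (\<lambda>g. 0)"
      using rG by (auto simp: series_mult_group_ring)
    then show ?thesis
      by (auto simp: \<eta>_def free_module_simps lmod_hom_smult[OF u rG q] lmod_hom_smult[OF v rG q]
          level_part_series_mult[OF r] series_mult_add_right[OF rG])
  qed
  moreover have "\<eta> (q \<oplus>\<^bsub>Q\<^esub> q') = \<eta> q \<oplus>\<^bsub>?F\<^esub> \<eta> q'"
    if q: "q \<in> carrier Q" and q': "q' \<in> carrier Q" for q q'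
    by (intro ext)
      (simp add: \<eta>_def free_module_simps lmod_hom_add[OF u q q'] lmod_hom_add[OF v q q'] level_part_def)
  ultimately have "\<eta> \<in> lmod_hom (group_ring K) Q ?F" by (intro lmod_homI) auto
  moreover have "lincomb (group_ring G) P b \<in> lmod_hom (group_ring K) ?F P"
    using P.lincomb_lmod_hom[OF b] by (rule lmod_hom_restrict_scalars[OF kernel_ring_subset])
  ultimately have "lincomb (group_ring G) P b \<circ> \<eta> \<in> lmod_hom (group_ring K) Q P"
    by (rule lmod_hom_comp)
  moreover have "(lincomb (group_ring G) P b \<circ> \<eta>) (d x) = x" if x: "x \<in> carrier P" for x
  proof -
    have "c x y = (\<lambda>g. 0)" if "y \<notin> Y" for y
      using lmod_hom_closed[OF c x] that by (auto simp: free_module_carrier)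
    then have "\<eta> (d x) = c x"
      using ud[OF x] vd[OF x] by (auto simp: \<eta>_def level_part_def fun_eq_iff)
    then show ?thesis using bc[OF x] by simp
  qed
  ultimately show thesis by (rule that)
qed

end

section \<open>Factorisations from a retraction\<close>

lemma (in group) delta_mult:
  assumes "g \<in> carrier G" "h \<in> carrier G"
  shows "series_mult G (delta g) (delta h) = delta (g \<otimes> h)"
proof
  fix x
  have "inv g \<otimes> x = h \<longleftrightarrow> x = g \<otimes> h" if "x \<in> carrier G"
    using that assms by (metis inv_solve_left m_closed)
  then show "series_mult G (delta g) (delta h) x = delta (g \<otimes> h) x"
    using assms by (simp add: series_mult_delta) (auto simp: delta_def)
qed

lemma novikov_finsum_apply:
  assumes "f \<in> A \<rightarrow> carrier (novikov_module G \<chi>)" "finite A"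
  shows "(\<Oplus>\<^bsub>novikov_module G \<chi>\<^esub>i\<in>A. f i) g = (\<Sum>i\<in>A. f i g)"
proof -
  interpret abelian_group "novikov_module G \<chi>" by (rule novikov_abelian_group)
  show ?thesis using assms(2,1) by (induction A rule: finite_induct) auto
qed

lemma novikov_bounded_below:
  assumes "w \<in> carrier (novikov_module G \<chi>)"
  obtains L where "\<And>g. w g \<noteq> 0 \<Longrightarrow> L \<le> \<chi> g"
proof -
  have fin: "finite {g. w g \<noteq> 0 \<and> \<chi> g \<le> 0}" using assms by (auto simp: novikov_module_carrier)
  have "Min (insert 0 (\<chi> ` {g. w g \<noteq> 0 \<and> \<chi> g \<le> 0})) \<le> \<chi> g" if "w g \<noteq> 0" for g
  proof (cases "\<chi> g \<le> 0")
    case True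
    then show ?thesis using that fin by (intro Min_le) auto
  next
    case False
    have "Min (insert 0 (\<chi> ` {g. w g \<noteq> 0 \<and> \<chi> g \<le> 0})) \<le> 0" using fin by (intro Min_le) auto
    then show ?thesis using False by simp
  qed
  then show thesis by (rule that)
qed

context graded_group
begin

lemma level_part_closed:
  "r \<in> carrier (group_ring G) \<Longrightarrow> level_part \<chi> A r \<in> carrier (group_ring G)"
  by (auto simp: group_ring_carrier level_part_def elim: rev_finite_subset split: if_splits)

lemma level_part_lmod_hom:
  "(\<lambda>q y. level_part \<chi> A (q y)) \<in>
    lmod_hom (group_ring K) (free_module (group_ring G) X) (free_module (group_ring G) X)"
proof (rule lmod_homI)
  fix q assume "q \<in> carrier (free_module (group_ring G) X)"
  moreover have "finite {y. level_part \<chi> A (q y) \<noteq> (\<lambda>g. 0)}" if "finite {y. q y \<noteq> (\<lambda>g. 0)}"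
    using that by (rule rev_finite_subset) (auto simp: level_part_def)
  ultimately show "(\<lambda>y. level_part \<chi> A (q y)) \<in> carrier (free_module (group_ring G) X)"
    by (auto simp: free_module_carrier level_part_closed) (auto simp: level_part_def)
next
  fix r q assume "r \<in> carrier (group_ring K)"
  then show "(\<lambda>y. level_part \<chi> A ((r \<odot>\<^bsub>free_module (group_ring G) X\<^esub> q) y)) =
      r \<odot>\<^bsub>free_module (group_ring G) X\<^esub> (\<lambda>y. level_part \<chi> A (q y))"
    by (simp add: free_module_simps level_part_series_mult)
qed (auto simp: free_module_simps level_part_def fun_eq_iff)

lemma free_module_bounded:
  assumes "q \<in> carrier (free_module (group_ring G) X)"
  obtains N where "\<And>y g. q y g \<noteq> 0 \<Longrightarrow> \<bar>\<chi> g\<bar> \<le> N"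
proof -
  let ?T = "\<Union>y\<in>{y. q y \<noteq> (\<lambda>g. 0)}. {g. q y g \<noteq> 0}"
  interpret ring "group_ring G" by (rule group_ring_ring)
  have "finite ?T"
    using assms free_module_coeff[OF assms] by (auto simp: free_module_carrier group_ring_carrier)
  then have "\<bar>\<chi> g\<bar> \<le> Max ((\<lambda>g. \<bar>\<chi> g\<bar>) ` ?T)" if "q y g \<noteq> 0" for y g
    using that by (intro Max_ge) (auto simp: fun_eq_iff)
  then show thesis by (rule that)
qed

text \<open>
  Here \<open>e\<close> stands for \<open>d p\<close> with \<open>p\<close> a generator, \<open>\<beta>\<close> for \<open>\<phi> \<rho>\<close> and \<open>v\<close> for \<open>\<phi> p\<close>. The hypothesis on
  \<open>\<beta>\<close> provides a bound only for untruncated multiples of \<open>e\<close>. If \<open>e\<close> lives in levels between \<open>- N\<close>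
  and \<open>N\<close>, truncation does nothing to \<open>a e\<close> for \<open>a\<close> in levels \<open>\<ge> N\<close> and kills it for \<open>a\<close> in
  levels \<open>< - N\<close>, and finitely many levels are left.
\<close>

lemma truncated_multiples_bounded_below:
  fixes X :: "'x set"
  defines "F \<equiv> free_module (group_ring G) X"
  assumes \<beta>: "\<beta> \<in> lmod_hom (group_ring K) F (novikov_module G \<chi>)"
    and e: "e \<in> carrier F" and v: "v \<in> carrier (novikov_module G \<chi>)"
    and \<beta>e: "\<And>a. a \<in> carrier (group_ring G) \<Longrightarrow> \<beta> (a \<odot>\<^bsub>F\<^esub> e) = series_mult G a v"
  obtains M where "\<And>a g. a \<in> carrier (group_ring G) \<Longrightarrow>
    \<beta> (\<lambda>y. level_part \<chi> {0..} ((a \<odot>\<^bsub>F\<^esub> e) y)) g \<noteq> 0 \<Longrightarrow> M \<le> \<chi> g"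
proof -
  interpret G: ring "group_ring G" by (rule group_ring_ring)
  interpret F: left_module "group_ring G" F unfolding F_def by (rule G.free_left_module)
  have \<beta>0: "\<beta> \<zero>\<^bsub>F\<^esub> = (\<lambda>g. 0)"
    using lmod_hom_zero[OF F.is_abelian_group novikov_abelian_group \<beta>] by simp
  define T where "T q = (\<lambda>y. level_part \<chi> {0..} (q y))" for q :: "'x \<Rightarrow> 'g \<Rightarrow> int"
  have T: "T \<in> lmod_hom (group_ring K) F F"
    unfolding F_def T_def by (rule level_part_lmod_hom)
  have aeT: "T (a \<odot>\<^bsub>F\<^esub> e) \<in> carrier F" if "a \<in> carrier (group_ring G)" for a
    using lmod_hom_closed[OF T] that e by simp
  define B where "B A \<longleftrightarrow> (\<exists>M. \<forall>a\<in>carrier (group_ring G). (\<forall>g. a g \<noteq> 0 \<longrightarrow> \<chi> g \<in> A) \<longrightarrow>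
      (\<forall>g. \<beta> (T (a \<odot>\<^bsub>F\<^esub> e)) g \<noteq> 0 \<longrightarrow> M \<le> \<chi> g))" for A
  have BI: "B A" if "\<And>a g. a \<in> carrier (group_ring G) \<Longrightarrow> (\<And>g. a g \<noteq> 0 \<Longrightarrow> \<chi> g \<in> A) \<Longrightarrow>
      \<beta> (T (a \<odot>\<^bsub>F\<^esub> e)) g \<noteq> 0 \<Longrightarrow> M \<le> \<chi> g" for A M
    unfolding B_def using that by blast
  have union: "B (A \<union> A')" if A: "B A" and A': "B A'" for A A'
  proof -
    obtain M where M: "\<And>a g. a \<in> carrier (group_ring G) \<Longrightarrow> (\<And>g. a g \<noteq> 0 \<Longrightarrow> \<chi> g \<in> A) \<Longrightarrow>
        \<beta> (T (a \<odot>\<^bsub>F\<^esub> e)) g \<noteq> 0 \<Longrightarrow> M \<le> \<chi> g" using A unfolding B_def by blast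
    obtain M' where M': "\<And>a g. a \<in> carrier (group_ring G) \<Longrightarrow> (\<And>g. a g \<noteq> 0 \<Longrightarrow> \<chi> g \<in> A') \<Longrightarrow>
        \<beta> (T (a \<odot>\<^bsub>F\<^esub> e)) g \<noteq> 0 \<Longrightarrow> M' \<le> \<chi> g" using A' unfolding B_def by blast
    show ?thesis
    proof (rule BI[of _ "min M M'"])
      fix a g assume a: "a \<in> carrier (group_ring G)"
        and supp: "\<And>g. a g \<noteq> 0 \<Longrightarrow> \<chi> g \<in> A \<union> A'" and nz: "\<beta> (T (a \<odot>\<^bsub>F\<^esub> e)) g \<noteq> 0"
      let ?a = "level_part \<chi> A a" and ?a' = "level_part \<chi> (- A) a"
      have cl: "?a \<in> carrier (group_ring G)" "?a' \<in> carrier (group_ring G)"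
        using a by (auto intro: level_part_closed)
      have "a = ?a \<oplus>\<^bsub>group_ring G\<^esub> ?a'" by (auto simp: level_part_def)
      then have "a \<odot>\<^bsub>F\<^esub> e = ?a \<odot>\<^bsub>F\<^esub> e \<oplus>\<^bsub>F\<^esub> ?a' \<odot>\<^bsub>F\<^esub> e"
        using F.smult_l_distr[OF cl e] by argo
      then have "\<beta> (T (a \<odot>\<^bsub>F\<^esub> e)) = (\<lambda>g. \<beta> (T (?a \<odot>\<^bsub>F\<^esub> e)) g + \<beta> (T (?a' \<odot>\<^bsub>F\<^esub> e)) g)"
        using cl e lmod_hom_add[OF T] lmod_hom_add[OF \<beta>] aeT by simp
      then have "\<beta> (T (?a \<odot>\<^bsub>F\<^esub> e)) g \<noteq> 0 \<or> \<beta> (T (?a' \<odot>\<^bsub>F\<^esub> e)) g \<noteq> 0" using nz by auto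
      moreover have "\<chi> h \<in> A" if "?a h \<noteq> 0" for h
        using that by (auto simp: level_part_def split: if_splits)
      moreover have "\<chi> h \<in> A'" if "?a' h \<noteq> 0" for h
        using that supp[of h] by (auto simp: level_part_def split: if_splits)
      ultimately show "min M M' \<le> \<chi> g" using M[OF cl(1)] M'[OF cl(2)] by (meson min.coboundedI1 min.coboundedI2)
    qed
  qed
  have single: "B {j}" for j
  proof (cases "\<exists>t\<in>carrier G. \<chi> t = j")
    case True
    then obtain t where t: "t \<in> carrier G" "\<chi> t = j" by blast
    have te: "delta t \<odot>\<^bsub>F\<^esub> e \<in> carrier F" using delta_closed[OF t(1)] e by simp
    let ?w = "\<beta> (T (delta t \<odot>\<^bsub>F\<^esub> e))"
    obtain M where M: "\<And>g. ?w g \<noteq> 0 \<Longrightarrow> M \<le> \<chi> g"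
      using novikov_bounded_below[OF lmod_hom_closed[OF \<beta> aeT[OF delta_closed[OF t(1)]]]] by blast
    show ?thesis
    proof (rule BI[of _ M])
      fix a g assume a: "a \<in> carrier (group_ring G)"
        and supp: "\<And>g. a g \<noteq> 0 \<Longrightarrow> \<chi> g \<in> {j}" and nz: "\<beta> (T (a \<odot>\<^bsub>F\<^esub> e)) g \<noteq> 0"
      \<comment> \<open>An element of a single level is a multiple of \<open>t\<close> by an element
        \<open>k\<close> of the group ring of \<open>K\<close>, and \<open>\<beta>\<close> and the
        truncation commute with \<open>k\<close>.\<close>
      define k where "k = series_mult G a (delta (inv t))"
      have kG: "k \<in> carrier (group_ring G)"
        unfolding k_def using a t by (intro series_mult_closed delta_closed) auto
      have k: "k \<in> carrier (group_ring K)"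
      proof -
        have "\<chi> g = 0" if "k g \<noteq> 0" for g
        proof -
          have "g \<in> carrier G" using that kG by (simp add: group_ring_carrier)
          then show ?thesis
            using that t supp[of "g \<otimes> t"] by (simp add: k_def series_mult_delta_right[OF a] chi_mult)
        qed
        then show ?thesis using kG by (simp add: kernel_ring_carrier)
      qed
      have "series_mult G k (delta t) = series_mult G a (delta \<one>)"
        unfolding k_def using a t by (simp add: series_mult_assoc delta_closed delta_mult)
      also have "\<dots> = a" using G.r_one[OF a] by simp
      finally have "a \<odot>\<^bsub>F\<^esub> e = k \<odot>\<^bsub>F\<^esub> (delta t \<odot>\<^bsub>F\<^esub> e)"
        using F.smult_assoc[OF kG delta_closed[OF t(1)] e] by simp
      then have "\<beta> (T (a \<odot>\<^bsub>F\<^esub> e)) = series_mult G k ?w"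
        using lmod_hom_smult[OF T k te] lmod_hom_smult[OF \<beta> k lmod_hom_closed[OF T te]] by simp
      then obtain h k' where "h \<in> carrier G" "k' \<in> carrier G" "h \<otimes> k' = g" "k h \<noteq> 0" "?w k' \<noteq> 0"
        using nz by (metis series_mult_nonzeroE)
      then show "M \<le> \<chi> g" using M[of k'] k by (auto simp: kernel_ring_carrier chi_mult)
    qed
  next
    case False
    show ?thesis
    proof (rule BI[of _ 0])
      fix a g assume a: "a \<in> carrier (group_ring G)"
        and supp: "\<And>g. a g \<noteq> 0 \<Longrightarrow> \<chi> g \<in> {j}" and nz: "\<beta> (T (a \<odot>\<^bsub>F\<^esub> e)) g \<noteq> 0"
      have "a = \<zero>\<^bsub>group_ring G\<^esub>" using False a supp by (auto simp: group_ring_carrier fun_eq_iff)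
      then have "T (a \<odot>\<^bsub>F\<^esub> e) = \<zero>\<^bsub>F\<^esub>"
        using F.smult_zero_left[OF e] lmod_hom_zero[OF F.is_abelian_group F.is_abelian_group T] by simp
      then show "0 \<le> \<chi> g" using nz \<beta>0 by simp
    qed
  qed
  have finite: "B A" if "finite A" for A
    using that
  proof (induction A rule: finite_induct)
    case empty
    show ?case using single[of 0] unfolding B_def by blast
  next
    case (insert j A)
    then show ?case using union[OF single[of j]] by simp
  qed
  obtain N where N: "\<And>y g. e y g \<noteq> 0 \<Longrightarrow> \<bar>\<chi> g\<bar> \<le> N"
    using free_module_bounded e unfolding F_def by blast
  have levels: "\<exists>h. a h \<noteq> 0 \<and> \<bar>\<chi> g - \<chi> h\<bar> \<le> N" if "(a \<odot>\<^bsub>F\<^esub> e) y g \<noteq> 0" for a y g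
  proof -
    have "series_mult G a (e y) g \<noteq> 0" using that by (simp add: F_def free_module_simps)
    then obtain h k where hk: "h \<in> carrier G" "k \<in> carrier G" "h \<otimes> k = g" "a h \<noteq> 0" "e y k \<noteq> 0"
      by (rule series_mult_nonzeroE)
    then have "\<chi> g - \<chi> h = \<chi> k" using chi_mult[of h k] by simp
    then show ?thesis using hk N[of y k] by auto
  qed
  obtain L where L: "\<And>g. v g \<noteq> 0 \<Longrightarrow> L \<le> \<chi> g" using novikov_bounded_below[OF v] by blast
  have high: "B {N..}"
  proof (rule BI[of _ "N + L"])
    fix a g assume a: "a \<in> carrier (group_ring G)"
      and supp: "\<And>g. a g \<noteq> 0 \<Longrightarrow> \<chi> g \<in> {N..}" and nz: "\<beta> (T (a \<odot>\<^bsub>F\<^esub> e)) g \<noteq> 0"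
    have "0 \<le> \<chi> g" if "(a \<odot>\<^bsub>F\<^esub> e) y g \<noteq> 0" for y g
      using levels[OF that] supp by fastforce
    then have "T (a \<odot>\<^bsub>F\<^esub> e) = a \<odot>\<^bsub>F\<^esub> e" by (auto simp: T_def level_part_def fun_eq_iff)
    then have "series_mult G a v g \<noteq> 0" using nz \<beta>e[OF a] by simp
    then obtain h k where hk: "h \<in> carrier G" "k \<in> carrier G" "h \<otimes> k = g" "a h \<noteq> 0" "v k \<noteq> 0"
      by (rule series_mult_nonzeroE)
    then show "N + L \<le> \<chi> g" using chi_mult[of h k] L[of k] supp[of h] by auto
  qed
  have low: "B {..<-N}"
  proof (rule BI[of _ 0])
    fix a g assume a: "a \<in> carrier (group_ring G)"
      and supp: "\<And>g. a g \<noteq> 0 \<Longrightarrow> \<chi> g \<in> {..<-N}" and nz: "\<beta> (T (a \<odot>\<^bsub>F\<^esub> e)) g \<noteq> 0"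
    have "\<chi> g < 0" if "(a \<odot>\<^bsub>F\<^esub> e) y g \<noteq> 0" for y g
      using levels[OF that] supp by fastforce
    then have "T (a \<odot>\<^bsub>F\<^esub> e) = \<zero>\<^bsub>F\<^esub>"
      by (fastforce simp: T_def level_part_def fun_eq_iff F_def free_module_simps)
    then show "0 \<le> \<chi> g" using nz \<beta>0 by simp
  qed
  have "B ({..<-N} \<union> ({j \<in> \<int>. -N \<le> j \<and> j \<le> N} \<union> {N..}))"
    by (intro union low high finite finite_int_segment)
  then obtain M where M: "\<And>a g. a \<in> carrier (group_ring G) \<Longrightarrow>
      (\<And>g. a g \<noteq> 0 \<Longrightarrow> \<chi> g \<in> {..<-N} \<union> ({j \<in> \<int>. -N \<le> j \<and> j \<le> N} \<union> {N..})) \<Longrightarrow>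
      \<beta> (T (a \<odot>\<^bsub>F\<^esub> e)) g \<noteq> 0 \<Longrightarrow> M \<le> \<chi> g" unfolding B_def by blast
  show thesis
  proof (rule that[of M])
    fix a g assume a: "a \<in> carrier (group_ring G)"
      and nz: "\<beta> (\<lambda>y. level_part \<chi> {0..} ((a \<odot>\<^bsub>F\<^esub> e) y)) g \<noteq> 0"
    show "M \<le> \<chi> g"
    proof (rule M[OF a])
      fix g assume "a g \<noteq> 0"
      then have "\<chi> g \<in> \<int>" using a chi_Ints by (simp add: group_ring_carrier)
      then show "\<chi> g \<in> {..<-N} \<union> ({j \<in> \<int>. -N \<le> j \<and> j \<le> N} \<union> {N..})" by auto
    qed (use nz in \<open>simp add: T_def\<close>)
  qed
qed

text \<open>
  The coefficient of \<open>\<psi> q\<close> at \<open>g\<close> has to be that of \<open>\<psi> (s g\<inverse> q)\<close> at \<open>s\<close>; so prescribing the coefficient at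
  \<open>s\<close> as that of \<open>\<gamma>\<close> determines a translation equivariant \<open>\<psi>\<close>. For \<open>g\<close> of low level, \<open>s g\<inverse> q\<close> lives in
  levels \<open>\<ge> 0\<close>, and then the bound on \<open>\<gamma>\<close> and the choice of \<open>s\<close> below it make the coefficient vanish.
\<close>

lemma novikov_map_of_bounded_kernel_map:
  fixes X :: "'x set"
  defines "F \<equiv> free_module (group_ring G) X"
  assumes \<gamma>: "\<gamma> \<in> lmod_hom (group_ring K) F (novikov_module G \<chi>)"
    and bound: "\<And>q g. q \<in> carrier F \<Longrightarrow> (\<And>y h. q y h \<noteq> 0 \<Longrightarrow> 0 \<le> \<chi> h) \<Longrightarrow> \<gamma> q g \<noteq> 0 \<Longrightarrow> M \<le> \<chi> g"
    and s: "s \<in> carrier G" "\<chi> s < M"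
  shows "(\<lambda>q g. if g \<in> carrier G then \<gamma> (delta (s \<otimes> inv g) \<odot>\<^bsub>F\<^esub> q) s else 0)
    \<in> lmod_hom (group_ring G) F (novikov_module G \<chi>)"
proof -
  interpret G: ring "group_ring G" by (rule group_ring_ring)
  interpret F: left_module "group_ring G" F unfolding F_def by (rule G.free_left_module)
  define \<psi> where "\<psi> = (\<lambda>q g. if g \<in> carrier G then \<gamma> (delta (s \<otimes> inv g) \<odot>\<^bsub>F\<^esub> q) s else 0)"
  have \<psi>_nz: "g \<in> carrier G \<and> \<gamma> (delta (s \<otimes> inv g) \<odot>\<^bsub>F\<^esub> q) s \<noteq> 0" if "\<psi> q g \<noteq> 0" for q g
    using that by (auto simp: \<psi>_def split: if_splits)
  have dF: "delta g \<odot>\<^bsub>F\<^esub> q \<in> carrier F" if "g \<in> carrier G" "q \<in> carrier F" for g q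
    using that delta_closed[of g G] by simp
  have ddF: "delta g \<odot>\<^bsub>F\<^esub> (delta h \<odot>\<^bsub>F\<^esub> q) = delta (g \<otimes> h) \<odot>\<^bsub>F\<^esub> q"
    if "g \<in> carrier G" "h \<in> carrier G" "q \<in> carrier F" for g h q
    using F.smult_assoc[OF delta_closed[OF that(1)] delta_closed[OF that(2)] that(3)] that
    by (simp add: delta_mult)
  have "\<psi> \<in> lmod_hom (group_ring G) F (novikov_module G \<chi>)"
  proof (rule translation_equivariant_imp_linear[OF F.left_module_axioms])
    show "\<psi> \<in> carrier F \<rightarrow> carrier (novikov_module G \<chi>)"
    proof
      fix q assume q: "q \<in> carrier F"
      obtain N where N: "\<And>y g. q y g \<noteq> 0 \<Longrightarrow> \<bar>\<chi> g\<bar> \<le> N"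
        using free_module_bounded q unfolding F_def by blast
      have low: "\<chi> s - N \<le> \<chi> g" if "\<psi> q g \<noteq> 0" for g
      proof (rule ccontr)
        assume lt: "\<not> \<chi> s - N \<le> \<chi> g"
        have g: "g \<in> carrier G" "\<gamma> (delta (s \<otimes> inv g) \<odot>\<^bsub>F\<^esub> q) s \<noteq> 0" using \<psi>_nz[OF that] by auto
        have "M \<le> \<chi> s"
        proof (rule bound[OF _ _ g(2)])
          show "delta (s \<otimes> inv g) \<odot>\<^bsub>F\<^esub> q \<in> carrier F" using g s q by (intro dF) auto
          fix y h assume "(delta (s \<otimes> inv g) \<odot>\<^bsub>F\<^esub> q) y h \<noteq> 0"
          then have "h \<in> carrier G" "q y (inv (s \<otimes> inv g) \<otimes> h) \<noteq> 0"
            using g s by (auto simp: F_def free_module_simps series_mult_delta split: if_splits)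
          then show "0 \<le> \<chi> h" using N[of y "inv (s \<otimes> inv g) \<otimes> h"] lt g s
            by (simp add: chi_mult chi_inv)
        qed
        then show False using s by simp
      qed
      have level: "finite {g. \<psi> q g \<noteq> 0 \<and> \<chi> g = j}" for j
      proof (cases "{g. \<psi> q g \<noteq> 0 \<and> \<chi> g = j} = {}")
        case False
        then obtain g0 where g0: "g0 \<in> carrier G" "\<chi> g0 = j" using \<psi>_nz by blast
        let ?h = "s \<otimes> inv g0"
        have h: "?h \<in> carrier G" using g0 s by simp
        let ?r = "\<gamma> (delta ?h \<odot>\<^bsub>F\<^esub> q)"
        have "{g. \<psi> q g \<noteq> 0 \<and> \<chi> g = j} \<subseteq> (\<lambda>x. inv ?h \<otimes> x) ` {x. ?r x \<noteq> 0 \<and> \<chi> x \<le> \<chi> s}"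
        proof
          fix g assume "g \<in> {g. \<psi> q g \<noteq> 0 \<and> \<chi> g = j}"
          then have g: "g \<in> carrier G" "\<gamma> (delta (s \<otimes> inv g) \<odot>\<^bsub>F\<^esub> q) s \<noteq> 0" "\<chi> g = j"
            using \<psi>_nz by auto
          \<comment> \<open>Elements of equal level differ by an element of \<open>K\<close>, so
            linearity of \<open>\<gamma>\<close> over \<open>K\<close> makes the coefficients of
            \<open>\<psi> q\<close> in level \<open>j\<close> those of the single series
            \<open>?r\<close> in the level of \<open>s\<close>.\<close>
          let ?k = "s \<otimes> inv g \<otimes> inv ?h"
          have k: "?k \<in> carrier G" "?k \<in> carrier K"
            using g g0 s by (simp_all add: mem_kernel chi_mult chi_inv)
          have "delta (s \<otimes> inv g) \<odot>\<^bsub>F\<^esub> q = delta ?k \<odot>\<^bsub>F\<^esub> (delta ?h \<odot>\<^bsub>F\<^esub> q)"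
            using ddF[OF k(1) h q] g s h by (simp add: m_assoc)
          then have "\<gamma> (delta (s \<otimes> inv g) \<odot>\<^bsub>F\<^esub> q) = series_mult G (delta ?k) ?r"
            using lmod_hom_smult[OF \<gamma> delta_closed[OF k(2)] dF[OF h q]] by simp
          then have "?r (inv ?k \<otimes> s) \<noteq> 0" using g(2) k s by (simp add: series_mult_delta)
          moreover have "inv ?k \<otimes> s = ?h \<otimes> g"
            using g s h by (simp add: inv_mult_group m_assoc)
          moreover have "\<chi> (?h \<otimes> g) = \<chi> s" using g g0 s by (simp add: chi_mult chi_inv)
          moreover have "g = inv ?h \<otimes> (?h \<otimes> g)" using g h by (simp add: m_assoc[symmetric])
          ultimately show "g \<in> (\<lambda>x. inv ?h \<otimes> x) ` {x. ?r x \<noteq> 0 \<and> \<chi> x \<le> \<chi> s}" by auto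
        qed
        moreover have "finite {x. ?r x \<noteq> 0 \<and> \<chi> x \<le> \<chi> s}"
          using lmod_hom_closed[OF \<gamma> dF[OF h q]] by (auto simp: novikov_module_carrier)
        ultimately show ?thesis by (blast intro: finite_surj)
      next
        case True
        show ?thesis unfolding True by simp
      qed
      have "finite {g. \<psi> q g \<noteq> 0 \<and> \<chi> g \<le> t}" for t
      proof (rule finite_subset)
        show "{g. \<psi> q g \<noteq> 0 \<and> \<chi> g \<le> t} \<subseteq>
            (\<Union>j\<in>{j \<in> \<int>. \<chi> s - N \<le> j \<and> j \<le> t}. {g. \<psi> q g \<noteq> 0 \<and> \<chi> g = j})"
          using low chi_Ints \<psi>_nz by auto
        show "finite (\<Union>j\<in>{j \<in> \<int>. \<chi> s - N \<le> j \<and> j \<le> t}. {g. \<psi> q g \<noteq> 0 \<and> \<chi> g = j})"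
          by (intro finite_UN_I finite_int_segment level)
      qed
      then show "\<psi> q \<in> carrier (novikov_module G \<chi>)"
        using \<psi>_nz by (auto simp: novikov_module_carrier)
    qed
  next
    fix q q' assume q: "q \<in> carrier F" "q' \<in> carrier F"
    show "\<psi> (q \<oplus>\<^bsub>F\<^esub> q') = (\<lambda>g. \<psi> q g + \<psi> q' g)"
    proof
      fix g
      show "\<psi> (q \<oplus>\<^bsub>F\<^esub> q') g = \<psi> q g + \<psi> q' g"
      proof (cases "g \<in> carrier G")
        case True
        then have sg: "s \<otimes> inv g \<in> carrier G" using s by simp
        have "\<gamma> (delta (s \<otimes> inv g) \<odot>\<^bsub>F\<^esub> (q \<oplus>\<^bsub>F\<^esub> q')) =
            (\<lambda>x. \<gamma> (delta (s \<otimes> inv g) \<odot>\<^bsub>F\<^esub> q) x + \<gamma> (delta (s \<otimes> inv g) \<odot>\<^bsub>F\<^esub> q') x)"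
          using F.smult_r_distr[OF delta_closed[OF sg] q] lmod_hom_add[OF \<gamma> dF[OF sg q(1)] dF[OF sg q(2)]]
          by simp
        then show ?thesis using True by (simp add: \<psi>_def)
      qed (simp add: \<psi>_def)
    qed
  next
    fix h g q assume h: "h \<in> carrier G" and g: "g \<in> carrier G" and q: "q \<in> carrier F"
    then show "\<psi> (delta h \<odot>\<^bsub>F\<^esub> q) g = \<psi> q (inv h \<otimes> g)"
      using s ddF[of "s \<otimes> inv g" h q] by (simp add: \<psi>_def inv_mult_group m_assoc)
  qed
  then show ?thesis by (simp add: \<psi>_def)
qed

text \<open>
  The retraction \<open>\<rho>\<close> is corrected to \<open>\<rho>'\<close>, for which \<open>\<phi> \<rho>'\<close> is bounded below on the elements of
  nonnegative level. It is still a retraction, because on \<open>d x\<close> its two terms are the values of \<open>\<rho>\<close> on the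
  two halves of \<open>d x\<close>.
\<close>

lemma novikov_factorisation_free:
  fixes P :: "('g \<Rightarrow> int, 'm) module" and X :: "'x set"
  defines "F \<equiv> free_module (group_ring G) X"
  assumes nontrivial: "\<exists>g\<in>carrier G. \<chi> g \<noteq> 0"
    and P: "left_module (group_ring G) P" and fg: "finitely_generated_module (group_ring G) P"
    and d: "d \<in> lmod_hom (group_ring G) P F"
    and \<rho>: "\<rho> \<in> lmod_hom (group_ring K) F P"
    and \<rho>d: "\<And>x. x \<in> carrier P \<Longrightarrow> \<rho> (d x) = x"
    and \<phi>: "\<phi> \<in> lmod_hom (group_ring G) P (novikov_module G \<chi>)"
  obtains \<psi> where "\<psi> \<in> lmod_hom (group_ring G) F (novikov_module G \<chi>)"
    and "\<And>x. x \<in> carrier P \<Longrightarrow> \<phi> x = \<psi> (d x)"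
proof -
  interpret G: ring "group_ring G" by (rule group_ring_ring)
  interpret F: left_module "group_ring G" F unfolding F_def by (rule G.free_left_module)
  interpret P: left_module "group_ring G" P by fact
  interpret PK: left_module "group_ring K" P by (rule kernel_left_module[OF P])
  note restrict = lmod_hom_restrict_scalars[OF kernel_ring_subset]
  define T where "T A q = (\<lambda>y. level_part \<chi> A (q y))" for A and q :: "'x \<Rightarrow> 'g \<Rightarrow> int"
  have T: "T A \<in> lmod_hom (group_ring K) F F" for A
    unfolding F_def T_def by (rule level_part_lmod_hom)
  define \<rho>' where "\<rho>' q = \<rho> (T {..<0} q) \<oplus>\<^bsub>P\<^esub> \<rho> (T {0..} (d (\<rho> q)))" for q
  have "(\<rho> \<circ> T {0..}) \<circ> (d \<circ> \<rho>) \<in> lmod_hom (group_ring K) F P"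
    by (rule lmod_hom_comp[OF lmod_hom_comp[OF \<rho> restrict[OF d]] lmod_hom_comp[OF T \<rho>]])
  then have \<rho>': "\<rho>' \<in> lmod_hom (group_ring K) F P"
    unfolding \<rho>'_def using PK.add_lmod_hom[OF lmod_hom_comp[OF T \<rho>]] by (simp add: o_def)
  have split: "q = T {..<0} q \<oplus>\<^bsub>F\<^esub> T {0..} q" for q
    by (auto simp: T_def level_part_def F_def free_module_simps fun_eq_iff)
  have \<rho>'d: "\<rho>' (d x) = x" if x: "x \<in> carrier P" for x
  proof -
    have dx: "d x \<in> carrier F" using d x by (rule lmod_hom_closed)
    have "\<rho>' (d x) = \<rho> (T {..<0} (d x) \<oplus>\<^bsub>F\<^esub> T {0..} (d x))"
      using lmod_hom_add[OF \<rho>] lmod_hom_closed[OF T dx] \<rho>d[OF x] by (simp add: \<rho>'_def)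
    then show ?thesis using split[of "d x"] \<rho>d[OF x] by simp
  qed
  obtain S where S: "finite S" "S \<subseteq> carrier P"
    and gen: "\<And>x. x \<in> carrier P \<Longrightarrow> \<exists>a\<in>S \<rightarrow> carrier (group_ring G). x = (\<Oplus>\<^bsub>P\<^esub>p\<in>S. a p \<odot>\<^bsub>P\<^esub> p)"
    using fg unfolding finitely_generated_module_def by blast
  have \<beta>: "\<phi> \<circ> \<rho> \<in> lmod_hom (group_ring K) F (novikov_module G \<chi>)"
    by (rule lmod_hom_comp[OF \<rho> restrict[OF \<phi>]])
  have "\<exists>M. \<forall>a\<in>carrier (group_ring G). \<forall>g.
      (\<phi> \<circ> \<rho>) (T {0..} (a \<odot>\<^bsub>F\<^esub> d p)) g \<noteq> 0 \<longrightarrow> M \<le> \<chi> g" if "p \<in> S" for p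
  proof -
    have p: "p \<in> carrier P" using that S by auto
    have *: "(\<phi> \<circ> \<rho>) (a \<odot>\<^bsub>F\<^esub> d p) = series_mult G a (\<phi> p)" if a: "a \<in> carrier (group_ring G)" for a
    proof -
      have "\<rho> (a \<odot>\<^bsub>F\<^esub> d p) = a \<odot>\<^bsub>P\<^esub> p"
        using lmod_hom_smult[OF d a p] \<rho>d[of "a \<odot>\<^bsub>P\<^esub> p"] a p by simp
      then show ?thesis using lmod_hom_smult[OF \<phi> a p] by simp
    qed
    show ?thesis
      using truncated_multiples_bounded_below[OF \<beta>[unfolded F_def] lmod_hom_closed[OF d p, unfolded F_def]
          lmod_hom_closed[OF \<phi> p] *[unfolded F_def]]
      unfolding T_def F_def by metis
  qed
  then obtain M where M: "\<And>p a g. p \<in> S \<Longrightarrow> a \<in> carrier (group_ring G) \<Longrightarrow>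
      \<phi> (\<rho> (T {0..} (a \<odot>\<^bsub>F\<^esub> d p))) g \<noteq> 0 \<Longrightarrow> M p \<le> \<chi> g"
    by (simp add: o_def) metis
  let ?M = "Min (insert 0 (M ` S))"
  have bound: "?M \<le> \<chi> g" if q: "q \<in> carrier F" and pos: "\<And>y h. q y h \<noteq> 0 \<Longrightarrow> 0 \<le> \<chi> h"
    and nz: "\<phi> (\<rho>' q) g \<noteq> 0" for q g
  proof -
    have "T {..<0} q = \<zero>\<^bsub>F\<^esub>"
      using pos by (fastforce simp: T_def level_part_def F_def free_module_simps fun_eq_iff)
    then have r0: "\<rho> (T {..<0} q) = \<zero>\<^bsub>P\<^esub>"
      using lmod_hom_zero[OF F.is_abelian_group P.is_abelian_group \<rho>] by simp
    obtain a where a: "a \<in> S \<rightarrow> carrier (group_ring G)" and xa: "\<rho> q = (\<Oplus>\<^bsub>P\<^esub>p\<in>S. a p \<odot>\<^bsub>P\<^esub> p)"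
      using gen[OF lmod_hom_closed[OF \<rho> q]] by blast
    have \<Phi>: "(\<phi> \<circ> \<rho>) \<circ> (T {0..} \<circ> d) \<in> lmod_hom (group_ring K) P (novikov_module G \<chi>)"
      by (rule lmod_hom_comp[OF lmod_hom_comp[OF restrict[OF d] T] \<beta>])
    have ap: "a p \<odot>\<^bsub>P\<^esub> p \<in> carrier P" if "p \<in> S" for p using that a S by auto
    have eq: "((\<phi> \<circ> \<rho>) \<circ> (T {0..} \<circ> d)) (a p \<odot>\<^bsub>P\<^esub> p) = \<phi> (\<rho> (T {0..} (a p \<odot>\<^bsub>F\<^esub> d p)))"
      if "p \<in> S" for p
      using that a S lmod_hom_smult[OF d, of "a p" p] by (auto simp: Pi_def subset_eq)
    have "\<rho> (T {0..} (d (\<rho> q))) \<in> carrier P"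
      by (intro lmod_hom_closed[OF \<rho>] lmod_hom_closed[OF T] lmod_hom_closed[OF d] q)
    then have "\<phi> (\<rho>' q) = ((\<phi> \<circ> \<rho>) \<circ> (T {0..} \<circ> d)) (\<rho> q)"
      by (simp add: \<rho>'_def r0)
    also have "\<dots> = (\<Oplus>\<^bsub>novikov_module G \<chi>\<^esub>p\<in>S. ((\<phi> \<circ> \<rho>) \<circ> (T {0..} \<circ> d)) (a p \<odot>\<^bsub>P\<^esub> p))"
      unfolding xa by (rule lmod_hom_finsum[OF P.is_abelian_group novikov_abelian_group \<Phi>]) (use ap in auto)
    finally have "\<phi> (\<rho>' q) g = (\<Sum>p\<in>S. ((\<phi> \<circ> \<rho>) \<circ> (T {0..} \<circ> d)) (a p \<odot>\<^bsub>P\<^esub> p) g)"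
      using ap lmod_hom_closed[OF \<Phi>] S by (simp only:) (rule novikov_finsum_apply, blast+)
    then obtain p where p: "p \<in> S" "\<phi> (\<rho> (T {0..} (a p \<odot>\<^bsub>F\<^esub> d p))) g \<noteq> 0"
      using nz eq by (metis (no_types, lifting) sum.neutral)
    then have "M p \<le> \<chi> g" using M[of p "a p" g] a by auto
    then show ?thesis using p S by (intro order_trans[OF Min_le[of _ "M p"]]) auto
  qed
  obtain s where s: "s \<in> carrier G" "\<chi> s < ?M"
  proof -
    \<comment> \<open>Powers of an element of negative level reach every low level.\<close>
    obtain t where t: "t \<in> carrier G" "\<chi> t < 0"
    proof -
      obtain g where "g \<in> carrier G" "\<chi> g \<noteq> 0" using nontrivial by blast
      then show thesis using that[of g] that[of "inv g"] by (cases "\<chi> g < 0") (auto simp: chi_inv)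
    qed
    have pow: "\<chi> (t [^] k) = real k * \<chi> t" for k :: nat
      by (induction k) (use t in \<open>auto simp: chi_mult algebra_simps\<close>)
    obtain k :: nat where "- ?M < real k * - \<chi> t"
      using reals_Archimedean3[of "- \<chi> t"] t by (metis neg_0_less_iff_less)
    then have "\<chi> (t [^] k) < ?M" unfolding pow by linarith
    then show thesis using that[of "t [^] k"] t by blast
  qed
  define \<psi> where "\<psi> = (\<lambda>q g. if g \<in> carrier G then (\<phi> \<circ> \<rho>') (delta (s \<otimes> inv g) \<odot>\<^bsub>F\<^esub> q) s else 0)"
  show thesis
  proof
    have "\<phi> \<circ> \<rho>' \<in> lmod_hom (group_ring K) F (novikov_module G \<chi>)"
      by (rule lmod_hom_comp[OF \<rho>' restrict[OF \<phi>]])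
    then show "\<psi> \<in> lmod_hom (group_ring G) F (novikov_module G \<chi>)"
      unfolding \<psi>_def F_def
      by (rule novikov_map_of_bounded_kernel_map[where M = ?M])
        (use bound s in \<open>auto simp: F_def\<close>)
    fix x assume x: "x \<in> carrier P"
    have \<phi>x: "\<phi> x \<in> carrier (novikov_module G \<chi>)" using \<phi> x by (rule lmod_hom_closed)
    show "\<phi> x = \<psi> (d x)"
    proof
      fix g
      show "\<phi> x g = \<psi> (d x) g"
      proof (cases "g \<in> carrier G")
        case True
        then have sg: "s \<otimes> inv g \<in> carrier G" using s by simp
        then have "delta (s \<otimes> inv g) \<odot>\<^bsub>P\<^esub> x \<in> carrier P" using delta_closed[OF sg] x by simp
        then have "(\<phi> \<circ> \<rho>') (delta (s \<otimes> inv g) \<odot>\<^bsub>F\<^esub> d x) = series_mult G (delta (s \<otimes> inv g)) (\<phi> x)"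
          using lmod_hom_smult[OF d delta_closed[OF sg] x] lmod_hom_smult[OF \<phi> delta_closed[OF sg] x]
            \<rho>'d[of "delta (s \<otimes> inv g) \<odot>\<^bsub>P\<^esub> x"]
          by simp
        then show ?thesis
          using True s sg by (simp add: \<psi>_def series_mult_delta inv_mult_group m_assoc)
      next
        case False
        then show ?thesis using \<phi>x by (auto simp: \<psi>_def novikov_module_carrier)
      qed
    qed
  qed
qed

text \<open>
  The dual basis embeds \<open>Q\<close> as a direct summand of a free module, to which \<open>d\<close> and \<open>\<rho>\<close> extend.
\<close>

lemma novikov_factorisation:
  fixes P :: "('g \<Rightarrow> int, 'm) module" and Q :: "('g \<Rightarrow> int, 'n) module"
  assumes nontrivial: "\<exists>g\<in>carrier G. \<chi> g \<noteq> 0"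
    and P: "left_module (group_ring G) P" and fg: "finitely_generated_module (group_ring G) P"
    and Q: "projective_module (group_ring G) Q"
    and d: "d \<in> lmod_hom (group_ring G) P Q"
    and \<rho>: "\<rho> \<in> lmod_hom (group_ring K) Q P"
    and \<rho>d: "\<And>x. x \<in> carrier P \<Longrightarrow> \<rho> (d x) = x"
    and \<phi>: "\<phi> \<in> lmod_hom (group_ring G) P (novikov_module G \<chi>)"
  shows "\<exists>\<psi>\<in>lmod_hom (group_ring G) Q (novikov_module G \<chi>). \<forall>x\<in>carrier P. \<phi> x = \<psi> (d x)"
proof -
  interpret Q: left_module "group_ring G" Q using Q by (simp add: projective_module_def)
  obtain X :: "'n set" and b c where db: "dual_basis (group_ring G) Q X b c"
    using Q by (rule projective_imp_dual_basis)
  let ?F = "free_module (group_ring G) X" and ?l = "lincomb (group_ring G) Q b"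
  have c: "c \<in> lmod_hom (group_ring G) Q ?F" and bc: "\<And>q. q \<in> carrier Q \<Longrightarrow> ?l (c q) = q"
    and l: "?l \<in> lmod_hom (group_ring G) ?F Q"
    using db Q.lincomb_lmod_hom[of b X] by (auto simp: dual_basis_def)
  have "\<rho> \<circ> ?l \<in> lmod_hom (group_ring K) ?F P"
    by (rule lmod_hom_comp[OF lmod_hom_restrict_scalars[OF kernel_ring_subset l] \<rho>])
  moreover have "(\<rho> \<circ> ?l) ((c \<circ> d) x) = x" if "x \<in> carrier P" for x
    using bc[OF lmod_hom_closed[OF d that]] \<rho>d[OF that] by simp
  ultimately obtain \<psi> where "\<psi> \<in> lmod_hom (group_ring G) ?F (novikov_module G \<chi>)"
    and "\<And>x. x \<in> carrier P \<Longrightarrow> \<phi> x = \<psi> ((c \<circ> d) x)"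
    using novikov_factorisation_free[OF nontrivial P fg lmod_hom_comp[OF d c] _ _ \<phi>] by metis
  then show ?thesis using lmod_hom_comp[OF c] by (intro bexI[of _ "\<psi> \<circ> c"]) auto
qed

end

section \<open>The equivalence\<close>

lemma integral_character_graded_group:
  assumes "group G" and "integral_character G \<chi>" and "\<chi> ` carrier G \<subseteq> \<int>"
  shows "graded_group G \<chi>"
  using assms
  by (auto simp: graded_group_def graded_group_axioms_def integral_character_def character_def
      hom_def real_group_def)

text \<open>
  The image is infinite, being isomorphic to the group of integers.
\<close>

lemma integral_character_nontrivial:
  assumes "group G" and "integral_character G \<chi>"
  shows "\<exists>g\<in>carrier G. \<chi> g \<noteq> 0"
proof (rule ccontr)
  assume "\<not> ?thesis"
  moreover have "carrier G \<noteq> {}" using assms(1) by (metis empty_iff group.is_monoid monoid.one_closed)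
  ultimately have "\<chi> ` carrier G = {0}" by auto
  then obtain h where "bij_betw h {0::real} (UNIV :: int set)"
    using assms(2) by (auto simp: integral_character_def is_iso_def iso_def integer_group_def)
  then have "finite (UNIV :: int set)" by (metis bij_betw_finite finite.emptyI finite_insert)
  then show False by (simp add: infinite_UNIV_int)
qed

context graded_group
begin

lemma kernel_chain_complex:
  assumes "chain_complex (group_ring G) C d"
  shows "chain_complex (group_ring K) C d"
  using assms kernel_left_module lmod_hom_restrict_scalars[OF kernel_ring_subset]
  unfolding chain_complex_def by blast

lemma novikov_cohomology_trivial:
  fixes C :: "int \<Rightarrow> ('g \<Rightarrow> int, 'm) module" and D :: "int \<Rightarrow> ('g \<Rightarrow> int, 'n) module"
  assumes nontrivial: "\<exists>g\<in>carrier G. \<chi> g \<noteq> 0"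
    and C: "chain_complex (group_ring G) C d"
    and proj: "\<And>i. projective_module (group_ring G) (C i)"
    and C0: "zero_module (C (n + 1))"
    and fg: "finitely_generated_module (group_ring G) (C n)"
    and D: "chain_complex (group_ring K) D e" and D0: "zero_module (D n)"
    and che: "chain_homotopy_equivalent (group_ring K) C d D e"
  shows "trivial_group (cohomology (group_ring G) C d (novikov_module G \<chi>) n)"
proof -
  have Cn: "left_module (group_ring G) (C n)" and d: "d n \<in> lmod_hom (group_ring G) (C n) (C (n - 1))"
    using C by (auto simp: chain_complex_def)
  obtain \<rho> where "\<rho> \<in> lmod_hom (group_ring K) (C (n - 1)) (C n)"
    and "\<And>x. x \<in> carrier (C n) \<Longrightarrow> \<rho> (d n x) = x"
    using retraction_of_top_boundary[OF kernel_chain_complex[OF C] D C0 D0 che] by blast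
  then show ?thesis
    unfolding top_cohomology_trivial_iff[of "group_ring G" C d "novikov_module G \<chi>" n, OF C novikov_left_module C0]
    using novikov_factorisation[OF nontrivial Cn fg proj d] by blast
qed

end

theorem theoremA:
  fixes G :: "('g, 'b) monoid_scheme"
    and \<chi> :: "'g \<Rightarrow> real"
    and C :: "int \<Rightarrow> ('g \<Rightarrow> int, 'm) module"
    and d :: "int \<Rightarrow> 'm \<Rightarrow> 'm"
    and n :: int
  assumes "group G"
    and "integral_character G \<chi>"
    and "\<chi> ` carrier G \<subseteq> \<int>"
    and "chain_complex (group_ring G) C d"
    and "\<forall>i. projective_module (group_ring G) (C i)"
    and "\<forall>i > n. zero_module (C i)"
    and "finitely_generated_module (group_ring G) (C n)"
  shows
    "((trivial_group (cohomology (group_ring G) C d (novikov_module G \<chi>) n) \<and>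
       trivial_group (cohomology (group_ring G) C d (novikov_module G (\<lambda>g. - \<chi> g)) n))
      \<longleftrightarrow>
      (\<exists>(D :: int \<Rightarrow> ('g \<Rightarrow> int, 'm) module) e.
         chain_complex (group_ring (character_kernel G \<chi>)) D e \<and>
         (\<forall>i. projective_module (group_ring (character_kernel G \<chi>)) (D i)) \<and>
         (\<forall>i > n - 1. zero_module (D i)) \<and>
         chain_homotopy_equivalent (group_ring (character_kernel G \<chi>)) C d D e))
     \<and>
     ((\<exists>(D :: int \<Rightarrow> ('g \<Rightarrow> int, 'd) module) e.
         chain_complex (group_ring (character_kernel G \<chi>)) D e \<and>
         (\<forall>i. projective_module (group_ring (character_kernel G \<chi>)) (D i)) \<and>
         (\<forall>i > n - 1. zero_module (D i)) \<and>
         chain_homotopy_equivalent (group_ring (character_kernel G \<chi>)) C d D e)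
      \<longrightarrow>
      (trivial_group (cohomology (group_ring G) C d (novikov_module G \<chi>) n) \<and>
       trivial_group (cohomology (group_ring G) C d (novikov_module G (\<lambda>g. - \<chi> g)) n)))"
proof -
  interpret graded_group G \<chi> using assms(1-3) by (rule integral_character_graded_group)
  interpret neg: graded_group G "\<lambda>g. - \<chi> g"
    by unfold_locales (auto simp: chi_mult chi_Ints)
  have nontrivial: "\<exists>g\<in>carrier G. \<chi> g \<noteq> 0" using assms(1,2) by (rule integral_character_nontrivial)
  have neg_kernel: "character_kernel G (\<lambda>g. - \<chi> g) = character_kernel G \<chi>"
    by (simp add: character_kernel_def kernel_def real_group_def)
  let ?N = "novikov_module G \<chi>" and ?N' = "novikov_module G (\<lambda>g. - \<chi> g)"
  let ?vanish = "trivial_group (cohomology (group_ring G) C d ?N n) \<and>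
    trivial_group (cohomology (group_ring G) C d ?N' n)"
  have Cn: "zero_module (C (n + 1))" using assms(6) by simp
  have d: "d n \<in> lmod_hom (group_ring G) (C n) (C (n - 1))"
    and Q: "left_module (group_ring G) (C (n - 1))"
    using assms(4) by (auto simp: chain_complex_def)
  have from_D: ?vanish
    if D: "chain_complex (group_ring (character_kernel G \<chi>)) D e"
      and D0: "\<forall>i > n - 1. zero_module (D i)"
      and che: "chain_homotopy_equivalent (group_ring (character_kernel G \<chi>)) C d D e"
    for D :: "int \<Rightarrow> ('g \<Rightarrow> int, 'x) module" and e
  proof -
    have Dn: "zero_module (D n)" using D0 by simp
    show ?thesis
      using novikov_cohomology_trivial[OF nontrivial assms(4) _ Cn assms(7) D Dn che]
        neg.novikov_cohomology_trivial[OF _ assms(4) _ Cn assms(7), unfolded neg_kernel, OF _ _ D Dn che]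
        nontrivial assms(5) by simp
  qed
  have to_D: "\<exists>(D :: int \<Rightarrow> ('g \<Rightarrow> int, 'm) module) e.
         chain_complex (group_ring (character_kernel G \<chi>)) D e \<and>
         (\<forall>i. projective_module (group_ring (character_kernel G \<chi>)) (D i)) \<and>
         (\<forall>i > n - 1. zero_module (D i)) \<and>
         chain_homotopy_equivalent (group_ring (character_kernel G \<chi>)) C d D e" if van: ?vanish
  proof -
    have pos: "\<exists>\<psi>\<in>lmod_hom (group_ring G) (C (n - 1)) ?N. \<forall>x\<in>carrier (C n). \<phi> x = \<psi> (d n x)"
      if "\<phi> \<in> lmod_hom (group_ring G) (C n) ?N" for \<phi>
      using van that top_cohomology_trivial_iff[OF assms(4) novikov_left_module Cn] by blast
    have neg: "\<exists>\<psi>\<in>lmod_hom (group_ring G) (C (n - 1)) ?N'. \<forall>x\<in>carrier (C n). \<phi> x = \<psi> (d n x)"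
      if "\<phi> \<in> lmod_hom (group_ring G) (C n) ?N'" for \<phi>
      using van that top_cohomology_trivial_iff[OF assms(4) neg.novikov_left_module Cn] by blast
    obtain \<rho> where \<rho>: "\<rho> \<in> lmod_hom (group_ring K) (C (n - 1)) (C n)"
      and \<rho>d: "\<And>x. x \<in> carrier (C n) \<Longrightarrow> \<rho> (d n x) = x"
      using retraction_from_factorisations[OF assms(5)[rule_format] assms(7) Q d pos neg] by blast
    have proj: "projective_module (group_ring K) (C i)" for i
      using assms(5) projective_over_kernel by blast
    obtain D :: "int \<Rightarrow> ('g \<Rightarrow> int, 'm) module" where "chain_complex (group_ring K) D d"
      and "\<And>i. projective_module (group_ring K) (D i)" and "\<And>i. i > n - 1 \<Longrightarrow> zero_module (D i)"
      and "chain_homotopy_equivalent (group_ring K) C d D d"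
      using lower_dimension[OF kernel_chain_complex[OF assms(4)] proj assms(6)[rule_format] \<rho> \<rho>d] by blast
    then show ?thesis by blast
  qed
  show ?thesis
  proof (intro conjI[OF iffI impI])
    assume "\<exists>(D :: int \<Rightarrow> ('g \<Rightarrow> int, 'm) module) e.
         chain_complex (group_ring (character_kernel G \<chi>)) D e \<and>
         (\<forall>i. projective_module (group_ring (character_kernel G \<chi>)) (D i)) \<and>
         (\<forall>i > n - 1. zero_module (D i)) \<and>
         chain_homotopy_equivalent (group_ring (character_kernel G \<chi>)) C d D e"
    then show ?vanish by (elim exE conjE) (rule from_D)
  next
    assume "\<exists>(D :: int \<Rightarrow> ('g \<Rightarrow> int, 'd) module) e.
         chain_complex (group_ring (character_kernel G \<chi>)) D e \<and>
         (\<forall>i. projective_module (group_ring (character_kernel G \<chi>)) (D i)) \<and>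
         (\<forall>i > n - 1. zero_module (D i)) \<and>
         chain_homotopy_equivalent (group_ring (character_kernel G \<chi>)) C d D e"
    then show ?vanish by (elim exE conjE) (rule from_D)
  qed (rule to_D)
qed

end
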